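(* Let $h$ be a fixed smooth density function of a measure on the Riemannian manifold $\mathcal M$, and let $\tilde f=\tilde f_\gamma$ be any one-parameter family of diffeomorphisms of $\mathcal M$ (as described in the context) with $\delta\tilde f:=\left.\frac{\partial \tilde f}{\partial\gamma}\right|_{\gamma=0}=X$. Then at every point where $h>0$, $$-\frac{\delta\tilde L h}{h}=\frac{\operatorname{div}(hX)}{h}=:\operatorname{div}_h X .$$
   Context: $\mathcal M$ is an $M$-dimensional Riemannian manifold; densities and integrals are taken with respect to the Riemannian (Lebesgue) volume, and $\operatorname{div}$ is the Riemannian divergence. "Smooth" means $C^\infty$. The family $\tilde f=\tilde f_\gamma$ is parameterized by a real number $\gamma$ near $0$: the map $\gamma\mapsto\tilde f_\gamma$ is $C^1$ from $\mathbb R$ to the family of $C^3$ diffeomorphisms of $\mathcal M$, and $\tilde f_0$ is the identity. Throughout, $\delta(\cdot):=\left.\frac{\partial(\cdot)}{\partial\gamma}\right|_{\gamma=0}$, so $X=\delta\tilde f$ is a vector field on $\mathcal M$. The transfer operator $\tilde L$ of $\tilde f$ gives the density after pushing forward by $\tilde f$: it is defined by $\int h\cdot(\Phi\circ\tilde f)=\int\tilde L h\cdot\Phi$ for all $C^2$ compactly supported $\Phi:\mathcal M\to\mathbb R$. Equivalently, $\tilde L h(x)=\frac{h(y)}{|\tilde f_*|(y)}$ with $y=\tilde f^{-1}(x)$, where $|\tilde f_*|$ is the Jacobian determinant of $\tilde f$ with respect to the Riemannian volume. *)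

theory Defs
  imports "HOL-Analysis.Analysis"
begin

section \<open>Finite and infinite differentiability on open sets\<close>

text \<open>\<^term>\<open>Ck_on k S f\<close> is meant for open \<^term>\<open>S\<close> only.\<close>

primrec Ck_on :: "nat \<Rightarrow> 'b::euclidean_space set \<Rightarrow> ('b \<Rightarrow> 'c::real_normed_vector) \<Rightarrow> bool" where
  "Ck_on 0 S f \<longleftrightarrow> continuous_on S f"
| "Ck_on (Suc k) S f \<longleftrightarrow> (\<forall>x\<in>S. f differentiable (at x)) \<and>
     (\<forall>v. Ck_on k S (\<lambda>x. frechet_derivative f (at x) v))"

definition smooth_on :: "'b::euclidean_space set \<Rightarrow> ('b \<Rightarrow> 'c::real_normed_vector) \<Rightarrow> bool" where
  "smooth_on S f \<longleftrightarrow> (\<forall>k. Ck_on k S f)"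

text \<open>
  \<^term>\<open>C1_Ck_on k W F\<close>: every iterated \<open>x\<close>-derivative of \<^term>\<open>F\<close> of order at most \<^term>\<open>k\<close>
  is continuous on the open set \<^term>\<open>W\<close> of pairs \<open>(\<gamma>, x)\<close> and has a \<open>\<gamma>\<close>-derivative that is
  continuous there.  This expresses in coordinates that \<open>\<gamma> \<mapsto> F \<gamma>\<close> is a \<open>C\<^sup>1\<close> curve in the space
  of \<open>C\<^sup>k\<close> maps with the topology of locally uniform convergence of all derivatives up to
  order \<^term>\<open>k\<close>.
\<close>

definition C1_C0_on ::
  "(real \<times> 'b::euclidean_space) set \<Rightarrow> (real \<Rightarrow> 'b \<Rightarrow> 'c::real_normed_vector) \<Rightarrow> bool" where
  "C1_C0_on W F \<longleftrightarrow> continuous_on W (\<lambda>(\<gamma>, x). F \<gamma> x) \<and>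
     (\<exists>F'. continuous_on W (\<lambda>(\<gamma>, x). F' \<gamma> x) \<and>
        (\<forall>(\<gamma>, x)\<in>W. ((\<lambda>s. F s x) has_vector_derivative F' \<gamma> x) (at \<gamma>)))"

primrec C1_Ck_on ::
  "nat \<Rightarrow> (real \<times> 'b::euclidean_space) set \<Rightarrow> (real \<Rightarrow> 'b \<Rightarrow> 'c::real_normed_vector) \<Rightarrow> bool" where
  "C1_Ck_on 0 W F \<longleftrightarrow> C1_C0_on W F"
| "C1_Ck_on (Suc k) W F \<longleftrightarrow> C1_C0_on W F \<and>
     (\<forall>(\<gamma>, x)\<in>W. F \<gamma> differentiable (at x)) \<and>
     (\<forall>v. C1_Ck_on k W (\<lambda>\<gamma> x. frechet_derivative (F \<gamma>) (at x) v))"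


section \<open>Smooth manifolds\<close>

text \<open>
  The manifold is the whole of a second countable Hausdorff type, its dimension is
  the cardinality of the index type \<open>'n\<close>, and a chart is a pair of an open domain and a coordinate
  map, whose values outside the domain are irrelevant.  The atlas need not be maximal.
\<close>

type_synonym ('a, 'n) chart = "'a set \<times> ('a \<Rightarrow> real ^ 'n)"

abbreviation dom_of :: "('a, 'n::finite) chart \<Rightarrow> 'a set" where
  "dom_of c \<equiv> fst c"

abbreviation coord :: "('a, 'n::finite) chart \<Rightarrow> 'a \<Rightarrow> real ^ 'n" where
  "coord c \<equiv> snd c"

abbreviation param :: "('a, 'n::finite) chart \<Rightarrow> real ^ 'n \<Rightarrow> 'a" where
  "param c \<equiv> inv_into (dom_of c) (coord c)"

definition smooth_atlas ::
  "('a::{second_countable_topology, t2_space}, 'n::finite) chart set \<Rightarrow> bool" where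
  "smooth_atlas A \<longleftrightarrow>
     (\<forall>c\<in>A. open (dom_of c) \<and> open (coord c ` dom_of c) \<and>
        homeomorphism (dom_of c) (coord c ` dom_of c) (coord c) (param c)) \<and>
     (\<Union>c\<in>A. dom_of c) = UNIV \<and>
     (\<forall>c\<in>A. \<forall>d\<in>A. smooth_on (coord c ` (dom_of c \<inter> dom_of d)) (coord d \<circ> param c))"

definition Ck_fun ::
  "('a::{second_countable_topology, t2_space}, 'n::finite) chart set \<Rightarrow> nat \<Rightarrow> ('a \<Rightarrow> real) \<Rightarrow> bool" where
  "Ck_fun A k u \<longleftrightarrow> (\<forall>c\<in>A. Ck_on k (coord c ` dom_of c) (u \<circ> param c))"

definition smooth_fun ::
  "('a::{second_countable_topology, t2_space}, 'n::finite) chart set \<Rightarrow> ('a \<Rightarrow> real) \<Rightarrow> bool" where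
  "smooth_fun A u \<longleftrightarrow> (\<forall>k. Ck_fun A k u)"

definition Ck_map ::
  "('a::{second_countable_topology, t2_space}, 'n::finite) chart set \<Rightarrow> nat \<Rightarrow> ('a \<Rightarrow> 'a) \<Rightarrow> bool" where
  "Ck_map A k f \<longleftrightarrow> continuous_on UNIV f \<and>
     (\<forall>c\<in>A. \<forall>d\<in>A. Ck_on k (coord c ` (dom_of c \<inter> f -` dom_of d)) (coord d \<circ> f \<circ> param c))"

definition Ck_diffeo ::
  "('a::{second_countable_topology, t2_space}, 'n::finite) chart set \<Rightarrow> nat \<Rightarrow> ('a \<Rightarrow> 'a) \<Rightarrow> bool" where
  "Ck_diffeo A k f \<longleftrightarrow> bij f \<and> Ck_map A k f \<and> Ck_map A k (inv f)"

text \<open>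
  A \<open>C\<^sup>1\<close> curve of \<open>C\<^sup>k\<close> diffeomorphisms.  Joint continuity makes the sets on which the coordinate
  expressions are considered open.
\<close>

definition C1_family_of_Ck_diffeos ::
  "('a::{second_countable_topology, t2_space}, 'n::finite) chart set \<Rightarrow> nat \<Rightarrow> real set
     \<Rightarrow> (real \<Rightarrow> 'a \<Rightarrow> 'a) \<Rightarrow> bool" where
  "C1_family_of_Ck_diffeos A k J f \<longleftrightarrow>
     (\<forall>\<gamma>\<in>J. Ck_diffeo A k (f \<gamma>)) \<and>
     continuous_on (J \<times> UNIV) (\<lambda>(\<gamma>, p). f \<gamma> p) \<and>
     (\<forall>c\<in>A. \<forall>d\<in>A.
        C1_Ck_on k {(\<gamma>, x). \<gamma> \<in> J \<and> x \<in> coord c ` dom_of c \<and> f \<gamma> (param c x) \<in> dom_of d}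
          (\<lambda>\<gamma> x. coord d (f \<gamma> (param c x))))"

text \<open>
  A vector field \<^term>\<open>X\<close> is given by its components: \<^term>\<open>X c p\<close> is the component vector at
  \<^term>\<open>p\<close> in the chart \<^term>\<open>c\<close>.  The field below is the velocity at \<open>\<gamma> = 0\<close> of the curves
  \<open>\<gamma> \<mapsto> f \<gamma> p\<close>, which start at \<^term>\<open>p\<close> if \<^term>\<open>f 0 = id\<close>.
\<close>

definition is_variation_field ::
  "('a::{second_countable_topology, t2_space}, 'n::finite) chart set \<Rightarrow> (real \<Rightarrow> 'a \<Rightarrow> 'a)
     \<Rightarrow> (('a, 'n) chart \<Rightarrow> 'a \<Rightarrow> real ^ 'n) \<Rightarrow> bool" where
  "is_variation_field A f X \<longleftrightarrow>
     (\<forall>c\<in>A. \<forall>p\<in>dom_of c. ((\<lambda>\<gamma>. coord c (f \<gamma> p)) has_vector_derivative X c p) (at 0))"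


section \<open>Riemannian metric, volume and divergence\<close>

text \<open>
  \<^term>\<open>g c p\<close> is the Gram matrix of the metric at \<^term>\<open>p\<close> in the coordinate frame of the chart
  \<^term>\<open>c\<close>; the last condition is the transformation law of a covariant 2-tensor.
\<close>

definition riemannian_manifold ::
  "('a::{second_countable_topology, t2_space}, 'n::finite) chart set
     \<Rightarrow> (('a, 'n) chart \<Rightarrow> 'a \<Rightarrow> real ^ 'n ^ 'n) \<Rightarrow> bool" where
  "riemannian_manifold A g \<longleftrightarrow> smooth_atlas A \<and>
     (\<forall>c\<in>A. smooth_on (coord c ` dom_of c) (g c \<circ> param c)) \<and>
     (\<forall>c\<in>A. \<forall>p\<in>dom_of c. transpose (g c p) = g c p \<and>
        (\<forall>v. v \<noteq> 0 \<longrightarrow> v \<bullet> (g c p *v v) > 0)) \<and>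
     (\<forall>c\<in>A. \<forall>d\<in>A. \<forall>p\<in>dom_of c \<inter> dom_of d. \<forall>v w.
        (let T = frechet_derivative (coord d \<circ> param c) (at (coord c p))
         in v \<bullet> (g c p *v w) = T v \<bullet> (g d p *v T w)))"

definition vol_density ::
  "(('a, 'n::finite) chart \<Rightarrow> 'a \<Rightarrow> real ^ 'n ^ 'n) \<Rightarrow> ('a, 'n) chart \<Rightarrow> 'a \<Rightarrow> real" where
  "vol_density g c p = sqrt (det (g c p))"

text \<open>The Riemannian volume is the unique Borel measure that is \<open>\<surd>(det g) dx\<close> in every chart.\<close>

definition riemannian_volume ::
  "('a::{second_countable_topology, t2_space}, 'n::finite) chart set
     \<Rightarrow> (('a, 'n) chart \<Rightarrow> 'a \<Rightarrow> real ^ 'n ^ 'n) \<Rightarrow> 'a measure" where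
  "riemannian_volume A g = (THE \<mu>. sets \<mu> = sets borel \<and>
     (\<forall>c\<in>A. \<forall>B\<in>sets borel. B \<subseteq> dom_of c \<longrightarrow>
        emeasure \<mu> B = (\<integral>\<^sup>+x\<in>coord c ` B. ennreal (vol_density g c (param c x)) \<partial>lborel)))"

text \<open>
  In a chart, \<open>div V = (1 / \<surd>(det g)) \<Sum>\<^sub>i \<partial>\<^sub>i (\<surd>(det g) V\<^sup>i)\<close>.  For a differentiable vector field
  the value does not depend on the chart, and the divergence is this common value.
\<close>

definition chart_divergence ::
  "(('a, 'n::finite) chart \<Rightarrow> 'a \<Rightarrow> real ^ 'n ^ 'n) \<Rightarrow> ('a, 'n) chart
     \<Rightarrow> (('a, 'n) chart \<Rightarrow> 'a \<Rightarrow> real ^ 'n) \<Rightarrow> 'a \<Rightarrow> real" where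
  "chart_divergence g c V p =
     (\<Sum>i\<in>UNIV. frechet_derivative
        (\<lambda>x. vol_density g c (param c x) * V c (param c x) $ i) (at (coord c p)) (axis i 1))
     / vol_density g c p"

definition divergence ::
  "('a, 'n::finite) chart set \<Rightarrow> (('a, 'n) chart \<Rightarrow> 'a \<Rightarrow> real ^ 'n ^ 'n)
     \<Rightarrow> (('a, 'n) chart \<Rightarrow> 'a \<Rightarrow> real ^ 'n) \<Rightarrow> 'a \<Rightarrow> real" where
  "divergence A g V p = (THE r. \<forall>c\<in>A. p \<in> dom_of c \<longrightarrow> chart_divergence g c V p = r)"

text \<open>The divergence with respect to the measure with density \<^term>\<open>h\<close>, where \<^term>\<open>h p > 0\<close>.\<close>

definition weighted_divergence ::
  "('a, 'n::finite) chart set \<Rightarrow> (('a, 'n) chart \<Rightarrow> 'a \<Rightarrow> real ^ 'n ^ 'n)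
     \<Rightarrow> ('a \<Rightarrow> real) \<Rightarrow> (('a, 'n) chart \<Rightarrow> 'a \<Rightarrow> real ^ 'n) \<Rightarrow> 'a \<Rightarrow> real" where
  "weighted_divergence A g h X p = divergence A g (\<lambda>c q. h q *\<^sub>R X c q) p / h p"


section \<open>Transfer operator\<close>

text \<open>
  Testing against functions determines a density only almost everywhere; its values at points are
  those of its continuous version.
\<close>

definition transfer ::
  "('a::{second_countable_topology, t2_space}, 'n::finite) chart set
     \<Rightarrow> (('a, 'n) chart \<Rightarrow> 'a \<Rightarrow> real ^ 'n ^ 'n) \<Rightarrow> ('a \<Rightarrow> 'a) \<Rightarrow> ('a \<Rightarrow> real) \<Rightarrow> 'a \<Rightarrow> real" where
  "transfer A g f h = (THE k. continuous_on UNIV k \<and>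
     (\<forall>\<Phi>. Ck_fun A 2 \<Phi> \<and> compact (closure {p. \<Phi> p \<noteq> 0}) \<longrightarrow>
        (\<integral>p. h p * \<Phi> (f p) \<partial>riemannian_volume A g) = (\<integral>p. k p * \<Phi> p \<partial>riemannian_volume A g)))"

end

theory Submission
  imports Defs
begin

text \<open>
  Write \<open>y\<^sub>\<gamma>\<close> for the preimage of \<open>x\<close> under \<open>f\<^sub>\<gamma>\<close>.  In a chart with Riemannian density
  \<open>\<rho> = \<surd>(det g)\<close>, the transferred density is
  \<open>(h \<rho>)(y\<^sub>\<gamma>) / (\<rho>(x) \<bar>det D f\<^sub>\<gamma>(y\<^sub>\<gamma>)\<bar>)\<close>.
  At \<open>\<gamma> = 0\<close> the point \<open>y\<^sub>\<gamma>\<close> moves with velocity \<open>- X\<close> and, since \<open>D f\<^sub>0\<close> is the identity, the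
  determinant grows at the rate \<open>tr (D X)\<close>.  The derivative is therefore
  \<open>- (D(h \<rho>) X + h \<rho> tr (D X)) / \<rho> = - (1 / \<rho>) \<Sum>\<^sub>i \<partial>\<^sub>i (\<rho> h X\<^sup>i)\<close>,
  which is \<open>- div (h X)\<close> in that chart.  The transferred density does not refer to a chart,
  so the same computation in all charts shows that the coordinate expression of the divergence is
  independent of the chart.

  Three points need work.  First, the volume and the transfer operator are given by descriptions that
  have to be shown to denote.  The volume is glued from the chart measures (\<open>borel_measure_glue\<close>), which
  agree on overlaps by the change of variables formula.  The same formula identifies the image of the
  measure with density \<open>h\<close> (\<open>distr_density_eq_pushforward\<close>), and \<open>C\<^sup>2\<close> bump functions with compact
  support determine a continuous density (\<open>continuous_density_le\<close>); together this gives the pointwise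
  formula \<open>transfer_eq_pushforward\<close>.

  Second, continuity of \<open>y\<^sub>\<gamma>\<close> at \<open>\<gamma> = 0\<close> is not assumed.  Brouwer's fixed point theorem produces a
  preimage of \<open>x\<close> near \<open>x\<close> (\<open>solve_near_identity\<close>), and injectivity of \<open>f\<^sub>\<gamma>\<close> shows that it is \<open>y\<^sub>\<gamma>\<close>.

  Third, the field \<open>X\<close> has to be differentiable, with \<open>D X\<close> equal to the \<open>\<gamma>\<close>-derivative of
  \<open>D f\<^sub>\<gamma>\<close> (\<open>velocity_field_has_derivative\<close>).  This follows from a difference quotient estimate that is
  uniform near the base point (\<open>C1_C0_difference_quotient\<close>).
\<close>

section \<open>Calculus of finitely differentiable maps\<close>

lemma Ck_on_cong:
  assumes "open S" "\<And>x. x \<in> S \<Longrightarrow> f x = g x" "Ck_on k S f"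
  shows "Ck_on k S g"
  using assms(2,3)
proof (induction k arbitrary: f g)
  case 0
  then show ?case by (simp cong: continuous_on_cong)
next
  case (Suc k)
  have diff: "f differentiable (at x)" if "x \<in> S" for x
    using Suc.prems that by auto
  have der: "(g has_derivative frechet_derivative f (at x)) (at x)" if "x \<in> S" for x
    using has_derivative_transform_within_open[OF diff[OF that, unfolded frechet_derivative_works] \<open>open S\<close> that]
      Suc.prems(1) by auto
  have eq: "frechet_derivative g (at x) = frechet_derivative f (at x)" if "x \<in> S" for x
    using frechet_derivative_at[OF der[OF that]] by simp
  have "Ck_on k S (\<lambda>x. frechet_derivative g (at x) v)" for v
    by (rule Suc.IH[of "\<lambda>x. frechet_derivative f (at x) v"]) (use Suc.prems(2) eq in auto)
  then show ?case using der by (auto simp: differentiable_def)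
qed

text \<open>
  Any family of derivatives may be used to establish differentiability of order \<^term>\<open>Suc k\<close>, not
  only the one that \<^const>\<open>frechet_derivative\<close> selects.
\<close>

lemma Ck_on_SucI:
  assumes "open S" "\<And>x. x \<in> S \<Longrightarrow> (f has_derivative f' x) (at x)" "\<And>v. Ck_on k S (\<lambda>x. f' x v)"
  shows "Ck_on (Suc k) S f"
proof -
  have "Ck_on k S (\<lambda>x. frechet_derivative f (at x) v)" for v
    by (rule Ck_on_cong[OF assms(1) _ assms(3)[of v]])
      (use assms(2) frechet_derivative_at in \<open>metis\<close>)
  then show ?thesis using assms(2) by (auto simp: differentiable_def)
qed

lemma Ck_on_has_derivative:
  "Ck_on (Suc k) S f \<Longrightarrow> x \<in> S \<Longrightarrow> (f has_derivative frechet_derivative f (at x)) (at x)"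
  by (auto simp: frechet_derivative_works)

lemma Ck_on_SucD: "Ck_on (Suc k) S f \<Longrightarrow> Ck_on k S f"
proof (induction k arbitrary: f)
  case 0
  then show ?case
    by (simp add: continuous_at_imp_continuous_on differentiable_imp_continuous_within)
qed (auto)

lemma Ck_on_mono: "Ck_on m S f \<Longrightarrow> k \<le> m \<Longrightarrow> Ck_on k S f"
  by (induction m rule: nat_induct) (metis Ck_on_SucD le_Suc_eq le_zero_eq)+

lemma Ck_on_continuous: "Ck_on k S f \<Longrightarrow> continuous_on S f"
  using Ck_on_mono[of k S f 0] by simp

lemma Ck_on_local:
  assumes "\<And>x. x \<in> S \<Longrightarrow> \<exists>T. open T \<and> x \<in> T \<and> Ck_on k T f"
  shows "Ck_on k S f"
  using assms
proof (induction k arbitrary: f)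
  case 0
  then have "\<forall>x\<in>S. continuous (at x) f"
    by (metis Ck_on.simps(1) continuous_on_eq_continuous_at)
  then show ?case by (simp add: continuous_at_imp_continuous_on)
next
  case (Suc k)
  then show ?case by (simp; meson)
qed

lemma Ck_on_const: "Ck_on k S (\<lambda>_. c)"
proof (induction k arbitrary: c)
  case (Suc k)
  have "frechet_derivative (\<lambda>_. c) (at x) = (\<lambda>_. 0)" for x :: 'a
    by (metis frechet_derivative_at has_derivative_const)
  then show ?case using Suc by simp
qed auto

lemma Ck_on_bounded_linear:
  assumes "bounded_linear f" "open S" shows "Ck_on k S f"
proof (cases k)
  case 0
  then show ?thesis by (simp add: assms linear_continuous_on)
next
  case (Suc m)
  show ?thesis unfolding Suc
    by (rule Ck_on_SucI[OF assms(2) bounded_linear_imp_has_derivative[OF assms(1)]])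
      (rule Ck_on_const)
qed

lemma Ck_on_add:
  assumes "open S" "Ck_on k S f" "Ck_on k S g" shows "Ck_on k S (\<lambda>x. f x + g x)"
  using assms(2,3)
proof (induction k arbitrary: f g)
  case (Suc k)
  show ?case
    by (rule Ck_on_SucI[OF assms(1), OF has_derivative_add[OF
       Ck_on_has_derivative[OF Suc.prems(1)] Ck_on_has_derivative[OF Suc.prems(2)]]])
      (use Suc in auto)
qed (auto intro: continuous_intros)

lemma Ck_on_sum:
  assumes "open S" "\<And>i. i \<in> I \<Longrightarrow> Ck_on k S (f i)" shows "Ck_on k S (\<lambda>x. \<Sum>i\<in>I. f i x)"
  using assms(2)
  by (induction I rule: infinite_finite_induct) (auto intro: Ck_on_const Ck_on_add[OF assms(1)])

lemma (in bounded_bilinear) Ck_on: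
  fixes f :: "'d::euclidean_space \<Rightarrow> 'a"
  assumes "open S" "Ck_on k S f" "Ck_on k S g" shows "Ck_on k S (\<lambda>x. f x ** g x)"
  using assms(2,3)
proof (induction k arbitrary: f g)
  case 0
  then show ?case by (auto intro: continuous_on)
next
  case (Suc k)
  show ?case
  proof (rule Ck_on_SucI[OF assms(1)])
    show "((\<lambda>x. f x ** g x) has_derivative (\<lambda>v. f x ** frechet_derivative g (at x) v
        + frechet_derivative f (at x) v ** g x)) (at x)" if "x \<in> S" for x
      by (rule FDERIV[OF Ck_on_has_derivative[OF Suc.prems(1) that] Ck_on_has_derivative[OF Suc.prems(2) that]])
    show "Ck_on k S (\<lambda>x. f x ** frechet_derivative g (at x) v
        + frechet_derivative f (at x) v ** g x)" for v
      using Suc.prems Suc.prems[THEN Ck_on_SucD] by (intro Ck_on_add assms(1) Suc.IH) auto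
  qed
qed

lemmas Ck_on_scaleR = bounded_bilinear.Ck_on[OF bounded_bilinear_scaleR]
lemmas Ck_on_inner = bounded_bilinear.Ck_on[OF bounded_bilinear_inner]

text \<open>
  The chain rule writes the derivative of a composition in the direction \<open>v\<close> as
  \<open>\<Sum>\<^sub>b (Df(x) v \<bullet> b) (D\<^sub>b g)(f x)\<close>, a sum of products to which the induction hypothesis applies.
\<close>

lemma Ck_on_compose:
  fixes f :: "'a::euclidean_space \<Rightarrow> 'b::euclidean_space" and g :: "'b \<Rightarrow> 'c::real_normed_vector"
  assumes "open S" "open T" "f ` S \<subseteq> T" "Ck_on k S f" "Ck_on k T g"
  shows "Ck_on k S (\<lambda>x. g (f x))"
  using assms(4,5)
proof (induction k arbitrary: g)
  case 0
  then show ?case using assms(3) by (auto intro: continuous_on_compose2)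
next
  case (Suc k)
  let ?D = "\<lambda>x v. \<Sum>b\<in>Basis. (frechet_derivative f (at x) v \<bullet> b) *\<^sub>R frechet_derivative g (at (f x)) b"
  show ?case
  proof (rule Ck_on_SucI[OF assms(1)])
    fix x assume x: "x \<in> S"
    have g: "(g has_derivative frechet_derivative g (at (f x))) (at (f x))"
      using Suc.prems(2) assms(3) x by (intro Ck_on_has_derivative) auto
    interpret g: bounded_linear "frechet_derivative g (at (f x))"
      using g by (rule has_derivative_bounded_linear)
    have eq: "frechet_derivative g (at (f x)) w = (\<Sum>b\<in>Basis. (w \<bullet> b) *\<^sub>R frechet_derivative g (at (f x)) b)"
      for w by (subst euclidean_representation[of w, symmetric]) (simp only: g.sum g.scaleR)
    have "((\<lambda>x. g (f x)) has_derivative (\<lambda>v. frechet_derivative g (at (f x)) (frechet_derivative f (at x) v))) (at x)"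
      by (rule has_derivative_compose[OF Ck_on_has_derivative[OF Suc.prems(1) x] g])
    then show "((\<lambda>x. g (f x)) has_derivative ?D x) (at x)"
      by (subst (asm) eq)
  next
    fix v
    have 1: "Ck_on k S (\<lambda>x. frechet_derivative f (at x) v)"
      using Suc.prems by auto
    have 2: "Ck_on k S (\<lambda>x. frechet_derivative g (at (f x)) b)" for b
      by (rule Suc.IH) (use Suc.prems Ck_on_SucD in auto)
    show "Ck_on k S (\<lambda>x. ?D x v)"
      by (intro Ck_on_sum[OF assms(1)] Ck_on_scaleR[OF assms(1)] Ck_on_inner[OF assms(1)] 1 2 Ck_on_const)
  qed
qed

lemma Ck_on_max_cube: "Ck_on 2 UNIV (\<lambda>t::real. max 0 t ^ 3)"
proof -
  have pow: "((\<lambda>t::real. max 0 t ^ Suc (Suc n)) has_real_derivative real (Suc (Suc n)) * max 0 t ^ Suc n) (at t)"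
    for t n
  proof (cases t "0::real" rule: linorder_cases)
    case less
    have "((\<lambda>t::real. 0) has_real_derivative 0) (at t)" by simp
    then have "((\<lambda>t::real. max 0 t ^ Suc (Suc n)) has_real_derivative 0) (at t)"
      by (rule has_field_derivative_transform_within_open[where S="{..<0}"]) (use less in auto)
    then show ?thesis using less by simp
  next
    case equal
    have "(\<lambda>y::real. max 0 y ^ Suc n) \<midarrow>0\<rightarrow> max 0 0 ^ Suc n"
      by (intro tendsto_intros)
    then have l: "(\<lambda>y::real. max 0 y ^ Suc n) \<midarrow>0\<rightarrow> 0" by simp
    have "(\<lambda>h::real. (max 0 (0 + h) ^ Suc (Suc n) - max 0 0 ^ Suc (Suc n)) / h) \<midarrow>0\<rightarrow> 0"
      by (rule Lim_transform_eventually[OF l])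
        (auto simp: eventually_at max_def intro!: exI[of _ 1])
    then show ?thesis using equal by (simp add: DERIV_def)
  next
    case greater
    have "((\<lambda>t::real. t ^ Suc (Suc n)) has_real_derivative real (Suc (Suc n)) * t ^ Suc n) (at t)"
      using DERIV_pow[of "Suc (Suc n)" t] by simp
    then have "((\<lambda>t::real. max 0 t ^ Suc (Suc n)) has_real_derivative real (Suc (Suc n)) * t ^ Suc n) (at t)"
      by (rule has_field_derivative_transform_within_open[where S="{0<..}"]) (use greater in auto)
    then show ?thesis using greater by simp
  qed
  have "Ck_on (Suc (Suc 0)) UNIV (\<lambda>t::real. max 0 t ^ 3)"
  proof (rule Ck_on_SucI)
    show "((\<lambda>t::real. max 0 t ^ 3) has_derivative (*) (3 * max 0 t ^ 2)) (at t)" for t :: real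
      using pow[of 1 t] by (simp add: has_field_derivative_def eval_nat_numeral)
    show "Ck_on (Suc 0) UNIV (\<lambda>t::real. 3 * max 0 t ^ 2 * v)" for v
    proof (rule Ck_on_SucI)
      have "((\<lambda>t. 3 * max 0 t ^ 2 * v) has_real_derivative 3 * (2 * max 0 t) * v) (at t)" for t
        using pow[of 0 t] by (intro DERIV_cmult DERIV_cmult_right) (simp add: eval_nat_numeral)
      then show "((\<lambda>t. 3 * max 0 t ^ 2 * v) has_derivative (*) (3 * (2 * max 0 t) * v)) (at t)" for t
        by (simp add: has_field_derivative_def)
      show "Ck_on 0 UNIV (\<lambda>t::real. 3 * (2 * max 0 t) * v * w)" for w
        by (auto intro!: continuous_intros)
    qed auto
  qed auto
  then show ?thesis by (simp add: numeral_2_eq_2)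
qed

text \<open>
  A nonnegative bump that is positive exactly on the ball of radius \<open>r > 0\<close> about \<open>a\<close>.  The cube
  makes it \<open>C\<^sup>2\<close>, which is the regularity required of the test functions.
\<close>

definition bump :: "'b::euclidean_space \<Rightarrow> real \<Rightarrow> 'b \<Rightarrow> real" where
  "bump a r u = max 0 (r\<^sup>2 - (u - a) \<bullet> (u - a)) ^ 3"

lemma bump_nonneg: "bump a r u \<ge> 0"
  by (simp add: bump_def)

lemma bump_pos_iff: "r > 0 \<Longrightarrow> bump a r u > 0 \<longleftrightarrow> u \<in> ball a r"

  by (auto simp: bump_def dist_norm norm_minus_commute max_def power2_norm_eq_inner[symmetric]
      abs_le_square_iff[symmetric] not_le[symmetric])

lemma Ck_on_bump: "Ck_on 2 UNIV (bump a r)"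
proof -
  have id: "Ck_on 2 UNIV (\<lambda>u. u - a)"
    using Ck_on_add[OF open_UNIV Ck_on_bounded_linear[OF bounded_linear_ident open_UNIV] Ck_on_const[of _ _ "- a"]]
    by simp
  have "Ck_on 2 UNIV (\<lambda>u. r\<^sup>2 + (-1) *\<^sub>R ((u - a) \<bullet> (u - a)))"
    by (intro Ck_on_add open_UNIV Ck_on_const Ck_on_scaleR Ck_on_inner id)
  then have "Ck_on 2 UNIV (\<lambda>u. r\<^sup>2 - (u - a) \<bullet> (u - a))" by simp
  from Ck_on_compose[OF open_UNIV open_UNIV subset_UNIV this Ck_on_max_cube]
  show ?thesis unfolding bump_def[abs_def] .
qed

section \<open>Determinants\<close>

lemma continuous_on_det [continuous_intros]:
  fixes M :: "'b::topological_space \<Rightarrow> real ^ 'n ^ 'n"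
  assumes "continuous_on S M" shows "continuous_on S (\<lambda>x. det (M x))"
  unfolding det_def using assms by (intro continuous_intros) auto

lemma differentiable_det:
  fixes M :: "'b::real_normed_vector \<Rightarrow> real ^ 'n ^ 'n"
  assumes "M differentiable (at x)" shows "(\<lambda>x. det (M x)) differentiable (at x)"
proof -
  obtain M' where M': "(M has_derivative M') (at x)"
    using assms by (auto simp: differentiable_def)
  have "((\<lambda>x. M x $ i $ j) has_derivative (\<lambda>v. M' v $ i $ j)) (at x)" for i j
    by (intro bounded_linear.has_derivative[OF bounded_linear_vec_nth] M')
  note prod = has_derivative_prod[OF this]
  have "(\<lambda>x. \<Prod>i\<in>UNIV. M x $ i $ p i) differentiable (at x)" for p :: "'n \<Rightarrow> 'n"
    unfolding differentiable_def by (rule exI, rule prod)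
  then show ?thesis
    unfolding det_def by (intro differentiable_sum differentiable_mult) auto
qed

text \<open>Jacobi's formula at the identity: the derivative of the determinant is the trace.\<close>

lemma has_real_derivative_det_mat_1:
  fixes D :: "real \<Rightarrow> real ^ 'n ^ 'n"
  assumes D: "\<And>i j. ((\<lambda>s. D s $ i $ j) has_real_derivative E $ i $ j) (at t)"
    and one: "D t = mat 1"
  shows "((\<lambda>s. det (D s)) has_real_derivative (\<Sum>i\<in>UNIV. E $ i $ i)) (at t)"
proof -
  define d where "d p = (\<Sum>i\<in>UNIV. E $ i $ p i * (\<Prod>j\<in>UNIV - {i}. (mat 1 :: real ^ 'n ^ 'n) $ j $ p j))"
    for p :: "'n \<Rightarrow> 'n"
  have "((\<lambda>s. \<Prod>i\<in>UNIV. D s $ i $ p i) has_real_derivative d p) (at t)" for p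
  proof -
    have *: "((\<lambda>s. D s $ i $ p i) has_derivative (\<lambda>v. v * E $ i $ p i)) (at t)" for i
      using D[of i "p i"] by (simp add: has_field_derivative_def mult.commute[of _ "E $ i $ p i"])
    have "((\<lambda>s. \<Prod>i\<in>UNIV. D s $ i $ p i) has_derivative
        (\<lambda>v. \<Sum>i\<in>UNIV. v * E $ i $ p i * (\<Prod>j\<in>UNIV - {i}. D t $ j $ p j))) (at t)"
      by (rule has_derivative_prod) (rule *)
    then show ?thesis
      unfolding has_field_derivative_def d_def one
      by (rule has_derivative_eq_rhs) (auto simp: sum_distrib_left sum_distrib_right mult_ac)
  qed
  then have der: "((\<lambda>s. det (D s)) has_real_derivative
      (\<Sum>p | p permutes UNIV. of_int (sign p) * d p)) (at t)"
    unfolding det_def by (intro DERIV_sum DERIV_cmult)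
  \<comment> \<open>A permutation other than the identity moves at least two indices, so every product with
    one factor removed still contains an off-diagonal entry of the identity matrix.\<close>
  have zero: "d p = 0" if p: "p permutes UNIV" "p \<noteq> id" for p :: "'n \<Rightarrow> 'n"
  proof -
    obtain k where k: "p k \<noteq> k" using p(2) by (auto simp: fun_eq_iff)
    have k': "p (p k) \<noteq> p k" using k permutes_inj[OF p(1)] by (auto dest: injD)
    have "(\<Prod>j\<in>UNIV - {i}. (mat 1 :: real ^ 'n ^ 'n) $ j $ p j) = 0" for i
    proof (rule prod_zero)
      show "\<exists>j\<in>UNIV - {i}. (mat 1 :: real ^ 'n ^ 'n) $ j $ p j = 0"
        using k k' by (cases "i = k") (auto simp: mat_def intro: bexI[of _ k] bexI[of _ "p k"])
    qed auto
    then show ?thesis unfolding d_def by (simp only: mult_zero_right sum.neutral_const)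
  qed
  have "(\<Sum>p | p permutes UNIV. of_int (sign p) * d p) = (\<Sum>p\<in>{id}. of_int (sign p) * d p)"
    by (rule sum.mono_neutral_right) (auto simp: zero permutes_id)
  also have "\<dots> = (\<Sum>i\<in>UNIV. E $ i $ i)"
    by (simp add: sign_id d_def mat_def)
  finally show ?thesis using der by simp
qed

lemma det_pos_if_positive_definite:
  fixes G :: "real ^ 'n ^ 'n"
  assumes "\<And>v. v \<noteq> 0 \<Longrightarrow> v \<bullet> (G *v v) > 0"
  shows "det G > 0"
proof (rule ccontr)
  assume neg: "\<not> det G > 0"
  \<comment> \<open>Positive definiteness persists along the segment from the identity to \<^term>\<open>G\<close>, so the
    determinant cannot vanish on it.\<close>
  define P where "P t = (1 - t) *\<^sub>R mat 1 + t *\<^sub>R G" for t :: real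
  have "continuous_on {0..1} (\<lambda>t. det (P t))"
    unfolding P_def by (intro continuous_intros)
  moreover have "det (P 1) \<le> 0" "0 \<le> det (P 0)"
    using neg by (auto simp: P_def)
  ultimately obtain t where t: "0 \<le> t" "t \<le> 1" "det (P t) = 0"
    using IVT2'[of "\<lambda>t. det (P t)" 1 0 0] by auto
  then obtain v where v: "v \<noteq> 0" "P t *v v = 0"
    using invertible_det_nz[of "P t"] by (metis invertible_left_inverse matrix_left_invertible_ker)
  have "v \<bullet> (P t *v v) = (1 - t) * (v \<bullet> v) + t * (v \<bullet> (G *v v))"
    by (simp add: P_def matrix_vector_mult_add_rdistrib scaleR_matrix_vector_assoc[symmetric]
        inner_add_right)
  moreover have "\<dots> > 0"
  proof (cases "t = 0")
    case True then show ?thesis using v by simp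
  next
    case False then show ?thesis using t v assms[OF v(1)]
      by (intro add_nonneg_pos mult_nonneg_nonneg mult_pos_pos) auto
  qed
  ultimately show False using v by simp
qed

lemma inner_axis_matrix: "axis i 1 \<bullet> (G *v axis j 1) = (G :: real ^ 'n ^ 'n) $ i $ j"
  by (simp add: inner_axis' matrix_vector_mult_basis column_def)

text \<open>
  How the determinant of a Gram matrix changes under a linear substitution; this is the
  transformation law of the Riemannian density.
\<close>

lemma det_pullback:
  fixes G H :: "real ^ 'n ^ 'n"
  assumes "linear T" "\<And>v w. v \<bullet> (G *v w) = T v \<bullet> (H *v T w)"
  shows "det G = (det (matrix T))\<^sup>2 * det H"
proof -
  have T: "T u = matrix T *v u" for u
    using assms(1) by simp
  have adj: "(matrix T *v u) \<bullet> z = u \<bullet> (transpose (matrix T) *v z)" for u z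
    by (metis dot_lmul_matrix inner_commute transpose_matrix_vector)
  have "v \<bullet> (G *v w) = v \<bullet> ((transpose (matrix T) ** H ** matrix T) *v w)" for v w
    unfolding assms(2)[of v w] T[of v] T[of w] adj
    by (simp add: matrix_vector_mul_assoc matrix_mul_assoc)
  then have "G = transpose (matrix T) ** H ** matrix T"
    by (metis (no_types, lifting) inner_axis_matrix vec_eq_iff)
  then show ?thesis by (simp add: det_mul power2_eq_square)
qed

section \<open>Change of variables for nonnegative functions\<close>

lemma det_reindex:
  fixes M :: "real ^ 'k ^ 'k" and \<sigma> :: "'m::finite \<Rightarrow> 'k"
  assumes "bij \<sigma>" shows "det (\<chi> i j. M $ \<sigma> i $ \<sigma> j) = det M"
proof -
  define \<Psi> where "\<Psi> p x = (if x \<in> UNIV then \<sigma> (p (inv \<sigma> x)) else x)" for p :: "'m \<Rightarrow> 'm" and x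
  have bij: "bij_betw \<Psi> {p. p permutes UNIV} {p. p permutes UNIV}"
    unfolding \<Psi>_def by (rule bij_betw_permutations) (use assms in auto)
  have \<Psi>: "\<Psi> p = map_permutation UNIV \<sigma> p" for p
    using assms by (auto simp: \<Psi>_def map_permutation_def fun_eq_iff restrict_id_def bij_is_surj)
  have inv: "inv \<sigma> (\<sigma> i) = i" for i
    using assms by (simp add: bij_is_inj)
  have "det M = (\<Sum>p | p permutes UNIV. of_int (sign (\<Psi> p)) * (\<Prod>i\<in>UNIV. M $ i $ \<Psi> p i))"
    unfolding det_def by (rule sum.reindex_bij_betw[OF bij, symmetric])
  also have "\<dots> = (\<Sum>p | p permutes UNIV. of_int (sign p) * (\<Prod>i\<in>UNIV. M $ \<sigma> i $ \<sigma> (p i)))"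
  proof (rule sum.cong[OF refl], goal_cases)
    case (1 p)
    have "(\<Prod>i\<in>UNIV. M $ i $ \<Psi> p i) = (\<Prod>i\<in>UNIV. M $ \<sigma> i $ \<Psi> p (\<sigma> i))"
      by (rule prod.reindex_bij_betw[OF assms, symmetric])
    moreover have "sign (\<Psi> p) = sign p"
      unfolding \<Psi> by (rule sign_map_permutation) (use 1 assms in \<open>auto simp: bij_is_inj\<close>)
    ultimately show ?case by (simp add: \<Psi>_def inv)
  qed
  finally show ?thesis by (simp add: det_def)
qed

lemma prod_Basis_cart: "(\<Prod>b\<in>Basis. f b) = (\<Prod>i\<in>UNIV. f (axis i 1))" for f :: "real ^ 'n \<Rightarrow> 'b::comm_monoid_mult"
proof -
  have "bij_betw (\<lambda>i::'n. axis i (1::real)) UNIV Basis"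
    by (auto simp: bij_betw_def inj_on_def axis_eq_axis Basis_vec_def)
  then show ?thesis by (rule prod.reindex_bij_betw[symmetric])
qed

lemma distr_lborel_reindex:
  fixes \<sigma> :: "'m::finite \<Rightarrow> 'k::finite"
  assumes "bij \<sigma>" shows "distr lborel borel (\<lambda>v :: real ^ 'k. \<chi> i. v $ \<sigma> i) = lborel"
proof (rule lborel_eqI[symmetric])
  let ?R = "\<lambda>v :: real ^ 'k. \<chi> i. v $ \<sigma> i" and ?R' = "\<lambda>v :: real ^ 'm. \<chi> i. v $ inv \<sigma> i"
  have inv: "inv \<sigma> (\<sigma> i) = i" "\<sigma> (inv \<sigma> j) = j" for i j
    using assms by (auto simp: bij_is_inj bij_is_surj surj_f_inv_f)
  have meas: "?R \<in> borel_measurable borel"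
    by (intro borel_measurable_continuous_onI continuous_intros)
  fix l u :: "real ^ 'm" assume le: "\<And>b. b \<in> Basis \<Longrightarrow> l \<bullet> b \<le> u \<bullet> b"
  have le': "l $ i \<le> u $ i" for i
    using le[of "axis i 1"] by (simp add: inner_axis)
  have "?R -` box l u = box (?R' l) (?R' u)"
    by (auto simp: mem_box_cart) (metis inv)+
  then have "emeasure (distr lborel borel ?R) (box l u) = emeasure lborel (box (?R' l) (?R' u))"
    using meas by (simp add: emeasure_distr)
  also have "\<dots> = ennreal (\<Prod>b\<in>Basis. (?R' u - ?R' l) \<bullet> b)"
    by (rule emeasure_lborel_box) (auto simp: Basis_vec_def inner_axis le')
  also have "(\<Prod>b\<in>Basis. (?R' u - ?R' l) \<bullet> b) = (\<Prod>i\<in>UNIV. (u - l) $ inv \<sigma> i)"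
    by (simp add: prod_Basis_cart inner_axis)
  also have "\<dots> = (\<Prod>i\<in>UNIV. (u - l) $ i)"
    by (rule prod.reindex_bij_betw) (use assms in \<open>simp add: bij_imp_bij_inv\<close>)
  also have "\<dots> = (\<Prod>b\<in>Basis. (u - l) \<bullet> b)"
    by (simp add: prod_Basis_cart inner_axis)
  finally show "emeasure (distr lborel borel ?R) (box l u) = (\<Prod>b\<in>Basis. (u - l) \<bullet> b)" .
qed simp

text \<open>
  A copy of a finite type that carries some well-order.  Relabelling coordinates along it extends
  the change of variables formula from well-ordered index types to all finite ones.
\<close>

typedef 'a ordered_copy = "UNIV :: 'a set" morphisms of_copy to_copy ..

lemma of_to_copy [simp]: "of_copy (to_copy x) = x" and to_of_copy [simp]: "to_copy (of_copy y) = y"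
  by (simp_all add: to_copy_inverse of_copy_inverse)

lemma bij_of_copy: "bij of_copy"
  by (rule bij_betw_byWitness[of _ to_copy]) auto

lemma bij_to_copy: "bij to_copy"
  by (rule bij_betw_byWitness[of _ of_copy]) auto

instance ordered_copy :: (finite) finite
proof
  have "(UNIV :: 'a ordered_copy set) = range to_copy"
    by (rule bij_is_surj[OF bij_to_copy, symmetric])
  then show "finite (UNIV :: 'a ordered_copy set)" by (metis finite finite_imageI)
qed

instantiation ordered_copy :: (finite) wellorder
begin

text \<open>The order is the one induced by an arbitrary enumeration of the finite type.\<close>

definition less_eq_ordered_copy :: "'a ordered_copy \<Rightarrow> 'a ordered_copy \<Rightarrow> bool" where
  "x \<le> y \<longleftrightarrow> to_nat (of_copy x) \<le> to_nat (of_copy y)"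

definition less_ordered_copy :: "'a ordered_copy \<Rightarrow> 'a ordered_copy \<Rightarrow> bool" where
  "x < y \<longleftrightarrow> to_nat (of_copy x) < to_nat (of_copy y)"

instance
proof
  fix P :: "'a ordered_copy \<Rightarrow> bool" and a
  assume step: "\<And>x. (\<And>y. y < x \<Longrightarrow> P y) \<Longrightarrow> P x"
  show "P a"
  proof (induction a rule: measure_induct_rule[of "\<lambda>x. to_nat (of_copy x)"])
    case (less x)
    show ?case by (rule step, rule less) (simp add: less_ordered_copy_def)
  qed
qed (auto simp: less_eq_ordered_copy_def less_ordered_copy_def of_copy_inject)

end

text \<open>
  For nonnegative functions the change of variables formula needs no integrability assumption:
  its two sides are integrable at the same time, and an infinite integral on one side
  matches an infinite one on the other.
\<close>

lemma nn_integral_set_eq_integral: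
  fixes p :: "real ^ 'k \<Rightarrow> real"
  assumes nn: "\<And>x. x \<in> S \<Longrightarrow> p x \<ge> 0" and meas: "(\<lambda>x. indicator S x * p x) \<in> borel_measurable borel"
  shows "(\<integral>\<^sup>+x\<in>S. ennreal (p x) \<partial>lborel) =
      (if set_integrable lebesgue S p then ennreal (integral S p) else \<infinity>)"
proof -
  have eq: "(\<integral>\<^sup>+x\<in>S. ennreal (p x) \<partial>lborel) = (\<integral>\<^sup>+x. ennreal (indicator S x * p x) \<partial>lborel)"
    by (intro nn_integral_cong) (auto simp: indicator_def)
  have iff: "set_integrable lebesgue S p \<longleftrightarrow> integrable lborel (\<lambda>x. indicator S x * p x)"
    using integrable_completion[of "\<lambda>x. indicator S x * p x" lborel] meas
    by (simp add: set_integrable_def)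
  show ?thesis
  proof (cases "set_integrable lebesgue S p")
    case True
    have "(\<integral>\<^sup>+x. ennreal (indicator S x * p x) \<partial>lborel) = ennreal (\<integral>x. indicator S x * p x \<partial>lborel)"
      by (rule nn_integral_eq_integral) (use True iff nn in \<open>auto simp: indicator_def\<close>)
    also have "(\<integral>x. indicator S x * p x \<partial>lborel) = (\<integral>x. indicator S x * p x \<partial>lebesgue)"
      by (rule integral_completion[symmetric]) (use meas in simp)
    also have "\<dots> = integral S p"
      using set_lebesgue_integral_eq_integral(2)[OF True] by (simp add: set_lebesgue_integral_def)
    finally show ?thesis using True eq by simp
  next
    case False
    have "(\<integral>\<^sup>+x. ennreal (indicator S x * p x) \<partial>lborel) = \<infinity>"
    proof (rule ccontr)
      assume "\<not> ?thesis"
      then have "integrable lborel (\<lambda>x. indicator S x * p x)"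
        using meas nn by (intro integrableI_nonneg) (auto simp: indicator_def less_top)
      with False iff show False by simp
    qed
    then show ?thesis using False eq by simp
  qed
qed

lemma nn_integral_change_of_variables_ordered:
  fixes G :: "real ^ 'n::{finite,wellorder} \<Rightarrow> real ^ 'n::_" and q :: "real ^ 'n::_ \<Rightarrow> real"
  assumes S: "S \<in> sets borel"
    and der: "\<And>x. x \<in> S \<Longrightarrow> (G has_derivative G' x) (at x within S)"
    and inj: "inj_on G S" and nonneg: "\<And>x. x \<in> S \<Longrightarrow> q (G x) \<ge> 0"
    and m1: "(\<lambda>y. indicator (G ` S) y * q y) \<in> borel_measurable borel"
    and m2: "(\<lambda>x. indicator S x * (\<bar>det (matrix (G' x))\<bar> * q (G x))) \<in> borel_measurable borel"
  shows "(\<integral>\<^sup>+y\<in>G ` S. ennreal (q y) \<partial>lborel) = (\<integral>\<^sup>+x\<in>S. ennreal (\<bar>det (matrix (G' x))\<bar> * q (G x)) \<partial>lborel)"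
proof -
  have S': "S \<in> sets lebesgue" using S by (simp add: sets_completionI_sets)
  have "(\<lambda>x. \<bar>det (matrix (G' x))\<bar> *\<^sub>R (vec (q (G x)) :: real ^ 1)) = (\<lambda>x. vec (\<bar>det (matrix (G' x))\<bar> * q (G x)))"
    by (simp add: vec_eq_iff fun_eq_iff)
  then have iff: "(set_integrable lebesgue (G ` S) q \<and> integral (G ` S) q = b) =
         (set_integrable lebesgue S (\<lambda>x. \<bar>det (matrix (G' x))\<bar> * q (G x)) \<and>
          integral S (\<lambda>x. \<bar>det (matrix (G' x))\<bar> * q (G x)) = b)" for b
    using has_absolute_integral_change_of_variables[OF S' der inj, of "\<lambda>y. vec (q y) :: real ^ 1" "vec b"]
    by (simp add: absolutely_integrable_on_1_iff integral_on_1_eq)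
  have 1: "(\<integral>\<^sup>+y\<in>G ` S. ennreal (q y) \<partial>lborel) =
      (if set_integrable lebesgue (G ` S) q then ennreal (integral (G ` S) q) else \<infinity>)"
    by (rule nn_integral_set_eq_integral[OF _ m1]) (use nonneg in auto)
  have 2: "(\<integral>\<^sup>+x\<in>S. ennreal (\<bar>det (matrix (G' x))\<bar> * q (G x)) \<partial>lborel) =
      (if set_integrable lebesgue S (\<lambda>x. \<bar>det (matrix (G' x))\<bar> * q (G x))
       then ennreal (integral S (\<lambda>x. \<bar>det (matrix (G' x))\<bar> * q (G x))) else \<infinity>)"
    by (rule nn_integral_set_eq_integral[OF _ m2]) (use nonneg in auto)
  show ?thesis
    using iff[of "integral (G ` S) q"] iff[of "integral S (\<lambda>x. \<bar>det (matrix (G' x))\<bar> * q (G x))"]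
    unfolding 1 2 by (auto simp only: if_True if_False split: if_split)
qed

lemma nn_integral_change_of_variables:
  fixes G :: "real ^ 'n \<Rightarrow> real ^ 'n" and q :: "real ^ 'n \<Rightarrow> real"
  assumes S: "S \<in> sets borel"
    and der: "\<And>x. x \<in> S \<Longrightarrow> (G has_derivative G' x) (at x within S)"
    and inj: "inj_on G S" and nonneg: "\<And>x. x \<in> S \<Longrightarrow> q (G x) \<ge> 0"
    and m1: "(\<lambda>y. indicator (G ` S) y * q y) \<in> borel_measurable borel"
    and m2: "(\<lambda>x. indicator S x * (\<bar>det (matrix (G' x))\<bar> * q (G x))) \<in> borel_measurable borel"
  shows "(\<integral>\<^sup>+y\<in>G ` S. ennreal (q y) \<partial>lborel) = (\<integral>\<^sup>+x\<in>S. ennreal (\<bar>det (matrix (G' x))\<bar> * q (G x)) \<partial>lborel)"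
proof -
  define R where "R = (\<lambda>v :: real ^ 'n. \<chi> i :: 'n ordered_copy. v $ of_copy i)"
  define R' where "R' = (\<lambda>v :: real ^ 'n ordered_copy. \<chi> i :: 'n. v $ to_copy i)"
  have RR [simp]: "R (R' u) = u" "R' (R v) = v" for u v
    by (auto simp: R_def R'_def vec_eq_iff)
  have lin: "bounded_linear R" "bounded_linear R'"
    by (auto simp: R_def R'_def linear_conv_bounded_linear[symmetric] intro!: linearI simp: vec_eq_iff)
  have meas: "R \<in> borel_measurable borel" "R' \<in> borel_measurable borel"
    using lin by (auto intro!: borel_measurable_continuous_onI linear_continuous_on)
  have distr: "lborel = distr lborel borel R'"
    unfolding R'_def by (rule distr_lborel_reindex[OF bij_to_copy, symmetric])
  define T where "T = R' -` S"
  define H where "H = (\<lambda>u. R (G (R' u)))"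
  define H' where "H' = (\<lambda>u v. R (G' (R' u) (R' v)))"
  have HT: "H ` T = R' -` (G ` S)"
  proof (intro set_eqI iffI)
    fix u assume "u \<in> R' -` (G ` S)"
    then obtain x where x: "x \<in> S" "R' u = G x" by auto
    have "H (R x) = u" "R x \<in> T" using x by (auto simp: H_def T_def simp flip: x(2))
    then show "u \<in> H ` T" by blast
  qed (auto simp: H_def T_def)
  have det: "det (matrix (H' u)) = det (matrix (G' (R' u)))" for u
  proof -
    have "matrix (H' u) = (\<chi> i j. matrix (G' (R' u)) $ of_copy i $ of_copy j)"
    proof -
      have axis: "R' (axis j 1) = axis (of_copy j) 1" for j
        by (auto simp: R'_def vec_eq_iff axis_def)
      show ?thesis unfolding matrix_def H'_def axis by (simp add: vec_eq_iff R_def)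
    qed
    then show ?thesis by (simp add: det_reindex[OF bij_of_copy])
  qed
  have *: "(\<integral>\<^sup>+v\<in>A. ennreal (p v) \<partial>lborel) = (\<integral>\<^sup>+u\<in>R' -` A. ennreal (p (R' u)) \<partial>lborel)"
    if "(\<lambda>v. indicator A v * p v) \<in> borel_measurable borel" for A p
  proof -
    have "(\<lambda>v. ennreal (indicator A v * p v)) \<in> borel_measurable borel"
      using that by measurable
    moreover have "(\<lambda>v. ennreal (indicator A v * p v)) = (\<lambda>v. ennreal (p v) * indicator A v)"
      by (auto simp: indicator_def)
    ultimately have "(\<lambda>v. ennreal (p v) * indicator A v) \<in> borel_measurable borel" by simp
    then show ?thesis
      by (subst distr, subst nn_integral_distr) (use meas in \<open>auto simp: indicator_def\<close>)
  qed
  have "(\<integral>\<^sup>+y\<in>G ` S. ennreal (q y) \<partial>lborel) = (\<integral>\<^sup>+u\<in>H ` T. ennreal (q (R' u)) \<partial>lborel)"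
    unfolding HT by (rule *[OF m1])
  also have "\<dots> = (\<integral>\<^sup>+u\<in>T. ennreal (\<bar>det (matrix (H' u))\<bar> * q (R' (H u))) \<partial>lborel)"
  proof (rule nn_integral_change_of_variables_ordered)
    show "T \<in> sets borel" unfolding T_def using measurable_sets_borel[OF meas(2) S] by simp
    show "(H has_derivative H' u) (at u within T)" if "u \<in> T" for u
    proof -
      have "(G has_derivative G' (R' u)) (at (R' u) within R' ` T)"
        using der[of "R' u"] that by (auto simp: T_def intro: has_derivative_subset)
      then have "((\<lambda>u. G (R' u)) has_derivative (\<lambda>v. G' (R' u) (R' v))) (at u within T)"
        by (rule has_derivative_in_compose[rotated]) (rule bounded_linear_imp_has_derivative[OF lin(2)])
      then show ?thesis unfolding H_def H'_def by (rule bounded_linear.has_derivative[OF lin(1)])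
    qed
    show "inj_on H T"
    proof (rule inj_onI)
      fix u v assume "u \<in> T" "v \<in> T" "H u = H v"
      then have "R' (R (G (R' u))) = R' (R (G (R' v)))" by (simp only: H_def)
      then have "R' u = R' v"
        using inj_onD[OF inj] \<open>u \<in> T\<close> \<open>v \<in> T\<close> by (simp add: T_def)
      then have "R (R' u) = R (R' v)" by (simp only:)
      then show "u = v" by simp
    qed
    show "q (R' (H x)) \<ge> 0" if "x \<in> T" for x using that nonneg by (simp add: H_def T_def)
    have "(\<lambda>y. indicator (H ` T) y * q (R' y)) = (\<lambda>y. indicator (G ` S) y * q y) \<circ> R'"
      by (auto simp: HT indicator_def fun_eq_iff)
    then show "(\<lambda>y. indicator (H ` T) y * q (R' y)) \<in> borel_measurable borel"
      using measurable_comp[OF meas(2) m1] by simp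
    have "(\<lambda>u. indicator T u * (\<bar>det (matrix (H' u))\<bar> * q (R' (H u)))) =
        (\<lambda>x. indicator S x * (\<bar>det (matrix (G' x))\<bar> * q (G x))) \<circ> R'"
      by (auto simp: T_def H_def det indicator_def fun_eq_iff)
    then show "(\<lambda>u. indicator T u * (\<bar>det (matrix (H' u))\<bar> * q (R' (H u)))) \<in> borel_measurable borel"
      using measurable_comp[OF meas(2) m2] by simp
  qed
  also have "\<dots> = (\<integral>\<^sup>+x\<in>S. ennreal (\<bar>det (matrix (G' x))\<bar> * q (G x)) \<partial>lborel)"
    unfolding *[OF m2] by (simp add: T_def H_def det)
  finally show ?thesis .
qed

section \<open>Gluing Borel measures along open covers\<close>

lemma open_cover_borel_partition:
  fixes U :: "'i \<Rightarrow> 'a::second_countable_topology set"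
  assumes "\<And>i. i \<in> I \<Longrightarrow> open (U i)" "(\<Union>i\<in>I. U i) = UNIV"
  obtains D :: "nat \<Rightarrow> 'a set" and \<iota> :: "nat \<Rightarrow> 'i"
  where "disjoint_family D" "(\<Union>n. D n) = UNIV" "\<And>n. D n \<in> sets borel"
    "\<And>n. \<iota> n \<in> I" "\<And>n. D n \<subseteq> U (\<iota> n)"
proof -
  obtain F where F: "F \<subseteq> U ` I" "countable F" "\<Union>F = \<Union>(U ` I)"
    using Lindelof[of "U ` I"] assms(1) by blast
  obtain I0 where I0: "countable I0" "I0 \<subseteq> I" "F = U ` I0"
    using F by (metis countable_subset_image)
  have cov: "(\<Union>i\<in>I0. U i) = UNIV" using F(3) I0(3) assms(2) by simp
  then have "I0 \<noteq> {}" by auto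
  define \<iota> where "\<iota> = from_nat_into I0"
  have rng: "range \<iota> = I0"
    unfolding \<iota>_def by (rule range_from_nat_into[OF \<open>I0 \<noteq> {}\<close> I0(1)])
  show ?thesis
  proof (rule that[of "disjointed (\<lambda>n. U (\<iota> n))" \<iota>])
    show "disjoint_family (disjointed (\<lambda>n. U (\<iota> n)))" by (rule disjoint_family_disjointed)
    show "(\<Union>n. disjointed (\<lambda>n. U (\<iota> n)) n) = UNIV"
      unfolding UN_disjointed_eq using cov rng by (metis image_image)
    have "range (\<lambda>n. U (\<iota> n)) \<subseteq> sets borel" using assms(1) rng I0(2) by auto
    from sets.range_disjointed_sets[OF this]
    show "disjointed (\<lambda>n. U (\<iota> n)) n \<in> sets borel" for n by blast
    show "\<iota> n \<in> I" for n using rng I0(2) by auto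
    show "disjointed (\<lambda>n. U (\<iota> n)) n \<subseteq> U (\<iota> n)" for n by (rule disjointed_subset)
  qed
qed

lemma emeasure_borel_partition:
  assumes "sets M = sets borel" "disjoint_family D" "(\<Union>n. D n) = UNIV" "\<And>n. D n \<in> sets borel" "B \<in> sets borel"
  shows "(\<Sum>n. emeasure M (B \<inter> D n)) = emeasure M B"
proof -
  have "(\<Sum>n. emeasure M (B \<inter> D n)) = emeasure M (\<Union>n. B \<inter> D n)"
    by (rule suminf_emeasure) (use assms in \<open>auto simp: disjoint_family_on_def\<close>)
  also have "(\<Union>n. B \<inter> D n) = B" using assms(3) by blast
  finally show ?thesis .
qed

lemma borel_measure_eqI_locally:
  fixes M N :: "'a::second_countable_topology measure"
  assumes sets: "sets M = sets borel" "sets N = sets borel"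
    and loc: "\<And>x. \<exists>U. open U \<and> x \<in> U \<and> (\<forall>B\<in>sets borel. B \<subseteq> U \<longrightarrow> emeasure M B = emeasure N B)"
  shows "M = N"
proof -
  define W where "W = {U. open U \<and> (\<forall>B\<in>sets borel. B \<subseteq> U \<longrightarrow> emeasure M B = emeasure N B)}"
  have cov: "(\<Union>U\<in>W. U) = UNIV" using loc unfolding W_def by blast
  have W: "open U" if "U \<in> W" for U using that unfolding W_def by blast
  obtain D :: "nat \<Rightarrow> 'a set" and \<iota> where D: "disjoint_family D" "(\<Union>n. D n) = UNIV"
      "\<And>n. D n \<in> sets borel" and \<iota>: "\<And>n. \<iota> n \<in> W" "\<And>n. D n \<subseteq> \<iota> n"
    by (rule open_cover_borel_partition[OF W cov], assumption, rule that)
  show ?thesis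
  proof (rule measure_eqI)
    fix B assume "B \<in> sets M"
    then have B: "B \<in> sets borel" using sets by simp
    have "emeasure M (B \<inter> D n) = emeasure N (B \<inter> D n)" for n
      using \<iota>[of n] B D(3)[of n] unfolding W_def by blast
    then show "emeasure M B = emeasure N B"
      using emeasure_borel_partition[OF sets(1) D B] emeasure_borel_partition[OF sets(2) D B] by simp
  qed (use sets in simp)
qed

lemma ennreal_suminf_swap:
  fixes f :: "nat \<Rightarrow> nat \<Rightarrow> ennreal" shows "(\<Sum>i. \<Sum>j. f i j) = (\<Sum>j. \<Sum>i. f i j)"
  using nn_integral_suminf[of "\<lambda>j i. f i j" "count_space UNIV"]
  by (simp add: nn_integral_count_space_nat)

text \<open>
  Measures on the members of an open cover that agree on overlaps glue to a global one.  It is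
  defined as the sum of the local measures over a countable Borel partition subordinate to the
  cover, which exists by the Lindeloef property.
\<close>

lemma borel_measure_glue:
  fixes U :: "'i \<Rightarrow> 'a::second_countable_topology set" and \<nu> :: "'i \<Rightarrow> 'a measure"
  assumes U: "\<And>i. i \<in> I \<Longrightarrow> open (U i)" "(\<Union>i\<in>I. U i) = UNIV"
    and sets: "\<And>i. i \<in> I \<Longrightarrow> sets (\<nu> i) = sets borel"
    and compat: "\<And>i j B. i \<in> I \<Longrightarrow> j \<in> I \<Longrightarrow> B \<in> sets borel \<Longrightarrow> B \<subseteq> U i \<inter> U j \<Longrightarrow>
      emeasure (\<nu> i) B = emeasure (\<nu> j) B"
  shows "\<exists>\<mu>. sets \<mu> = sets borel \<and>
    (\<forall>i\<in>I. \<forall>B\<in>sets borel. B \<subseteq> U i \<longrightarrow> emeasure \<mu> B = emeasure (\<nu> i) B)"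
proof -
  obtain D :: "nat \<Rightarrow> 'a set" and \<iota> where D: "disjoint_family D" "(\<Union>n. D n) = UNIV"
      "\<And>n. D n \<in> sets borel" and \<iota>: "\<And>n. \<iota> n \<in> I" "\<And>n. D n \<subseteq> U (\<iota> n)"
    using open_cover_borel_partition[of I U] U by auto
  define m where "m B = (\<Sum>n. emeasure (\<nu> (\<iota> n)) (B \<inter> D n))" for B
  define \<mu> where "\<mu> = measure_of UNIV (sets borel) m"
  have sets_\<mu>: "sets \<mu> = sets borel"
    unfolding \<mu>_def using sets.sets_measure_of_eq[of borel] by simp
  have "countably_additive (sets borel) m"
    unfolding countably_additive_def
  proof (intro allI impI)
    fix B :: "nat \<Rightarrow> 'a set"
    assume B: "range B \<subseteq> sets borel" "disjoint_family B" "(\<Union>i. B i) \<in> sets borel"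
    have "(\<Sum>i. m (B i)) = (\<Sum>n. \<Sum>i. emeasure (\<nu> (\<iota> n)) (B i \<inter> D n))"
      unfolding m_def by (rule ennreal_suminf_swap)
    also have "\<dots> = (\<Sum>n. emeasure (\<nu> (\<iota> n)) (\<Union>i. B i \<inter> D n))"
      by (intro suminf_cong suminf_emeasure)
        (use B D(3) sets[OF \<iota>(1)] in \<open>auto simp: disjoint_family_on_def\<close>)
    finally show "(\<Sum>i. m (B i)) = m (\<Union>i. B i)" by (simp add: m_def)
  qed
  then have em: "emeasure \<mu> B = m B" if "B \<in> sets borel" for B
    unfolding \<mu>_def using that sets.sigma_algebra_axioms[of borel]
    by (intro emeasure_measure_of_sigma) (auto simp: positive_def m_def)
  have "emeasure \<mu> B = emeasure (\<nu> i) B" if i: "i \<in> I" and B: "B \<in> sets borel" "B \<subseteq> U i" for i B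
  proof -
    have "emeasure (\<nu> (\<iota> n)) (B \<inter> D n) = emeasure (\<nu> i) (B \<inter> D n)" for n
      by (rule compat) (use i B D(3) \<iota>[of n] in auto)
    then have "emeasure \<mu> B = (\<Sum>n. emeasure (\<nu> i) (B \<inter> D n))"
      by (simp add: em[OF B(1)] m_def)
    also have "\<dots> = emeasure (\<nu> i) B"
      by (rule emeasure_borel_partition[OF sets[OF i] D B(1)])
    finally show ?thesis .
  qed
  with sets_\<mu> show ?thesis by blast
qed

lemma sets_borel_continuous_on_vimage:
  assumes "continuous_on U F" "U \<in> sets borel" "B \<in> sets borel"
  shows "U \<inter> F -` B \<in> sets borel"
proof -
  have "F \<in> borel_measurable (restrict_space borel U)"
    by (rule borel_measurable_continuous_on_restrict[OF assms(1)])
  from measurable_sets[OF this assms(3)] show ?thesis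
    using assms(2) by (simp add: sets_restrict_space_iff space_restrict_space Int_commute)
qed

section \<open>The Riemannian volume in charts\<close>

locale riemannian =
  fixes A :: "('a::{second_countable_topology, t2_space}, 'n::finite) chart set"
    and g :: "('a, 'n) chart \<Rightarrow> 'a \<Rightarrow> real ^ 'n ^ 'n"
  assumes riemannian_manifold: "riemannian_manifold A g"
begin

text \<open>The open subset of coordinate space onto which a chart maps its domain.\<close>

abbreviation img :: "('a, 'n) chart \<Rightarrow> (real ^ 'n) set" where "img c \<equiv> coord c ` dom_of c"

abbreviation vol :: "'a measure" where "vol \<equiv> riemannian_volume A g"

lemma atlas: "smooth_atlas A"
  using riemannian_manifold by (simp add: riemannian_manifold_def)

lemma open_dom: "c \<in> A \<Longrightarrow> open (dom_of c)"
  and open_img: "c \<in> A \<Longrightarrow> open (img c)"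
  and homeomorphism_chart: "c \<in> A \<Longrightarrow> homeomorphism (dom_of c) (img c) (coord c) (param c)"
  and charts_cover: "(\<Union>c\<in>A. dom_of c) = UNIV"
  using atlas by (auto simp: smooth_atlas_def)

lemma chart_at: obtains c where "c \<in> A" "p \<in> dom_of c"
  using charts_cover by blast

lemma param_coord: "c \<in> A \<Longrightarrow> p \<in> dom_of c \<Longrightarrow> param c (coord c p) = p"
  using homeomorphism_chart[of c] by (simp add: homeomorphism_def)

lemma coord_param: "u \<in> img c \<Longrightarrow> coord c (param c u) = u"
  by (rule f_inv_into_f)

lemma param_dom: "u \<in> img c \<Longrightarrow> param c u \<in> dom_of c"
  by (rule inv_into_into)

lemma inj_on_coord: "c \<in> A \<Longrightarrow> inj_on (coord c) (dom_of c)"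
  by (rule inj_on_inverseI[of _ "param c"]) (rule param_coord)

lemma continuous_on_coord: "c \<in> A \<Longrightarrow> continuous_on (dom_of c) (coord c)"
  and continuous_on_param: "c \<in> A \<Longrightarrow> continuous_on (img c) (param c)"
  using homeomorphism_chart[of c] by (auto simp: homeomorphism_def)

lemma coord_image_eq: "c \<in> A \<Longrightarrow> B \<subseteq> dom_of c \<Longrightarrow> coord c ` B = img c \<inter> param c -` B"
  by (auto simp: param_coord subset_iff image_iff)

lemma open_coord_image: "c \<in> A \<Longrightarrow> open U \<Longrightarrow> U \<subseteq> dom_of c \<Longrightarrow> open (coord c ` U)"
  unfolding coord_image_eq
  by (rule continuous_open_preimage[OF continuous_on_param open_img])

lemma borel_coord_image: "c \<in> A \<Longrightarrow> B \<in> sets borel \<Longrightarrow> B \<subseteq> dom_of c \<Longrightarrow> coord c ` B \<in> sets borel"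
  unfolding coord_image_eq
  by (rule sets_borel_continuous_on_vimage[OF continuous_on_param borel_open[OF open_img]])

lemma smooth_metric: "c \<in> A \<Longrightarrow> smooth_on (img c) (g c \<circ> param c)"
  using riemannian_manifold by (simp add: riemannian_manifold_def)

lemma det_metric_pos: "c \<in> A \<Longrightarrow> p \<in> dom_of c \<Longrightarrow> det (g c p) > 0"
  using riemannian_manifold by (intro det_pos_if_positive_definite) (simp add: riemannian_manifold_def)

lemma vol_density_pos: "c \<in> A \<Longrightarrow> p \<in> dom_of c \<Longrightarrow> vol_density g c p > 0"
  by (simp add: vol_density_def det_metric_pos)

lemma differentiable_vol_density:
  assumes "c \<in> A" "u \<in> img c"
  shows "(\<lambda>u. vol_density g c (param c u)) differentiable (at u)"
proof -
  have "Ck_on 1 (img c) (g c \<circ> param c)"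
    using smooth_metric[OF assms(1)] by (simp add: smooth_on_def)
  then have "(\<lambda>u. g c (param c u)) differentiable (at u)"
    using Ck_on_has_derivative[of 0 "img c" "g c \<circ> param c" u] assms(2)
    by (auto simp: differentiable_def o_def)
  then have "(\<lambda>u. det (g c (param c u))) differentiable (at u)"
    by (rule differentiable_det)
  then obtain L where L: "((\<lambda>u. det (g c (param c u))) has_derivative L) (at u)"
    by (auto simp: differentiable_def)
  have "det (g c (param c u)) > 0" by (rule det_metric_pos[OF assms(1) param_dom[OF assms(2)]])
  from has_derivative_real_sqrt[OF this L] show ?thesis
    by (auto simp: vol_density_def differentiable_def)
qed

lemma continuous_on_vol_density: "c \<in> A \<Longrightarrow> continuous_on (img c) (\<lambda>u. vol_density g c (param c u))"
  by (intro continuous_at_imp_continuous_on ballI differentiable_imp_continuous_within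
      differentiable_vol_density)

lemma transition_Ck:
  "c \<in> A \<Longrightarrow> d \<in> A \<Longrightarrow> Ck_on k (coord c ` (dom_of c \<inter> dom_of d)) (coord d \<circ> param c)"
  using atlas by (simp add: smooth_atlas_def smooth_on_def)

lemma transition_has_derivative:
  assumes "c \<in> A" "d \<in> A" "p \<in> dom_of c" "p \<in> dom_of d"
  shows "(coord d \<circ> param c has_derivative frechet_derivative (coord d \<circ> param c) (at (coord c p)))
    (at (coord c p))"
  by (rule Ck_on_has_derivative[OF transition_Ck[OF assms(1,2), of "Suc 0"]]) (use assms in auto)

lemma vol_density_transition:
  assumes "c \<in> A" "d \<in> A" "p \<in> dom_of c" "p \<in> dom_of d"
  shows "vol_density g c p =
    \<bar>det (matrix (frechet_derivative (coord d \<circ> param c) (at (coord c p))))\<bar> * vol_density g d p"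
proof -
  let ?T = "frechet_derivative (coord d \<circ> param c) (at (coord c p))"
  have "linear ?T"
    using transition_has_derivative[OF assms] by (rule has_derivative_linear)
  moreover have "v \<bullet> (g c p *v w) = ?T v \<bullet> (g d p *v ?T w)" for v w
    using riemannian_manifold assms unfolding riemannian_manifold_def Let_def by blast
  ultimately have "det (g c p) = (det (matrix ?T))\<^sup>2 * det (g d p)"
    by (rule det_pullback)
  then show ?thesis by (simp add: vol_density_def real_sqrt_mult)
qed

text \<open>
  The measure \<open>\<surd>(det g) dx\<close> of a single chart, as a Borel measure on the whole manifold that vanishes
  outside the domain of the chart.
\<close>

definition chart_volume :: "('a, 'n) chart \<Rightarrow> 'a measure" where
  "chart_volume c = distr (density (restrict_space lborel (img c))
     (\<lambda>u. ennreal (vol_density g c (param c u)))) borel (param c)"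

lemma sets_chart_volume [simp, measurable_cong]: "sets (chart_volume c) = sets borel"
  by (simp add: chart_volume_def)

lemma measurable_param: "c \<in> A \<Longrightarrow> param c \<in> borel_measurable (restrict_space borel (img c))"
  by (rule borel_measurable_continuous_on_restrict[OF continuous_on_param])

lemma measurable_vol_density:
  "c \<in> A \<Longrightarrow> (\<lambda>u. vol_density g c (param c u)) \<in> borel_measurable (restrict_space borel (img c))"
  by (rule borel_measurable_continuous_on_restrict[OF continuous_on_vol_density])

lemma nn_integral_chart_volume:
  assumes c: "c \<in> A" and q: "q \<in> borel_measurable borel" and B: "B \<subseteq> dom_of c" "B \<in> sets borel"
  shows "(\<integral>\<^sup>+p\<in>B. q p \<partial>chart_volume c) =
    (\<integral>\<^sup>+u\<in>coord c ` B. ennreal (vol_density g c (param c u)) * q (param c u) \<partial>lborel)"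
proof -
  let ?R = "restrict_space lborel (img c)"
  have sets_R: "sets ?R = sets (restrict_space borel (img c))"
    by (simp add: sets_restrict_space)
  have m: "param c \<in> borel_measurable ?R"
    "(\<lambda>u. ennreal (vol_density g c (param c u))) \<in> borel_measurable ?R"
    using measurable_param[OF c] measurable_vol_density[OF c]
    by (auto simp: measurable_cong_sets[OF sets_R refl])
  have qB: "(\<lambda>p. q p * indicator B p) \<in> borel_measurable borel"
    using q B(2) by (auto intro!: borel_measurable_times_ennreal)
  have "(\<integral>\<^sup>+p\<in>B. q p \<partial>chart_volume c) =
      (\<integral>\<^sup>+u. ennreal (vol_density g c (param c u)) * (q (param c u) * indicator B (param c u)) \<partial>?R)"
    unfolding chart_volume_def
    by (subst nn_integral_distr)
      (use m qB measurable_compose[OF m(1) qB] in \<open>auto simp: nn_integral_density\<close>)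
  also have "\<dots> = (\<integral>\<^sup>+u\<in>img c. ennreal (vol_density g c (param c u)) * (q (param c u) * indicator B (param c u)) \<partial>lborel)"
    using open_img[OF c] by (subst nn_integral_restrict_space) auto
  also have "\<dots> = (\<integral>\<^sup>+u\<in>coord c ` B. ennreal (vol_density g c (param c u)) * q (param c u) \<partial>lborel)"
    by (intro nn_integral_cong) (auto simp: coord_image_eq[OF c B(1)] indicator_def)
  finally show ?thesis .
qed

lemma emeasure_chart_volume:
  assumes "c \<in> A" "B \<subseteq> dom_of c" "B \<in> sets borel"
  shows "emeasure (chart_volume c) B =
    (\<integral>\<^sup>+u\<in>coord c ` B. ennreal (vol_density g c (param c u)) \<partial>lborel)"
  using nn_integral_chart_volume[OF assms(1) _ assms(2,3), of "\<lambda>_. 1"] assms(3) by simp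

text \<open>
  An injective map that is \<open>C\<^sup>1\<close> in a pair of charts transforms chart integrals by its Jacobian
  determinant.  For the identity this compares the volumes of two charts; for a diffeomorphism of
  the manifold it computes the push-forward of a density.
\<close>

lemma nn_integral_chart_image:
  assumes c: "c \<in> A" and d: "d \<in> A" and B: "B \<in> sets borel" "B \<subseteq> W" "f ` B \<in> sets borel"
    and W: "open W" "W \<subseteq> dom_of c" "f ` W \<subseteq> dom_of d"
    and f: "inj f"
    and der: "Ck_on 1 (coord c ` W) (coord d \<circ> f \<circ> param c)"
    and k: "\<And>p. k p \<ge> 0" "k \<in> borel_measurable borel"
  shows "(\<integral>\<^sup>+v\<in>coord d ` f ` B. ennreal (vol_density g d (param d v)) * ennreal (k (param d v)) \<partial>lborel) =
    (\<integral>\<^sup>+u\<in>coord c ` B. ennreal (\<bar>det (matrix (frechet_derivative (coord d \<circ> f \<circ> param c) (at u)))\<bar>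
        * (vol_density g d (f (param c u)) * k (f (param c u)))) \<partial>lborel)"
proof -
  let ?G = "coord d \<circ> f \<circ> param c"
  let ?D = "\<lambda>u. \<bar>det (matrix (frechet_derivative ?G (at u)))\<bar>"
  let ?q = "\<lambda>v. vol_density g d (param d v) * k (param d v)"
  have BW: "coord c ` B \<subseteq> coord c ` W" and fBW: "f ` B \<subseteq> dom_of d" using B W by auto
  have oW: "open (coord c ` W)" by (rule open_coord_image[OF c W(1,2)])
  have pW: "param c u \<in> W" "u \<in> img c" if "u \<in> coord c ` W" for u
    using that W(2) param_coord[OF c] by auto
  have sB: "coord c ` B \<in> sets borel" using borel_coord_image[OF c B(1)] B W by auto
  have sfB: "coord d ` f ` B \<in> sets borel" by (rule borel_coord_image[OF d B(3) fBW])
  have GB: "coord d ` f ` B = ?G ` (coord c ` B)"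
    using B(2) W(2) param_coord[OF c] by (force simp: image_iff)
  have contG: "continuous_on (coord c ` W) ?G" using der by (rule Ck_on_continuous)
  have GW: "?G ` (coord c ` W) \<subseteq> img d"
  proof
    fix v assume "v \<in> ?G ` (coord c ` W)"
    then obtain u where "u \<in> coord c ` W" "v = coord d (f (param c u))" by auto
    then show "v \<in> img d" using pW(1) W(3) by blast
  qed
  have nn: "?q (?G u) \<ge> 0" if "u \<in> coord c ` W" for u
    using that pW(1)[OF that] W(3) less_imp_le[OF vol_density_pos[OF d]] k(1)
    by (auto simp: image_subset_iff param_coord[OF d])
  have m_on: "(\<lambda>v. indicator (img d) v * ?q v) \<in> borel_measurable borel"
  proof -
    have "?q \<in> borel_measurable (restrict_space borel (img d))"
      by (intro borel_measurable_times measurable_vol_density[OF d] measurable_compose[OF measurable_param[OF d] k(2)])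
    then show ?thesis
      by (subst (asm) borel_measurable_restrict_space_iff) (use open_img[OF d] in auto)
  qed
  have "(\<integral>\<^sup>+v\<in>?G ` (coord c ` B). ennreal (?q v) \<partial>lborel) =
      (\<integral>\<^sup>+u\<in>coord c ` B. ennreal (?D u * ?q (?G u)) \<partial>lborel)"
  proof (rule nn_integral_change_of_variables[OF sB])
    show "(?G has_derivative frechet_derivative ?G (at u)) (at u within coord c ` B)" if "u \<in> coord c ` B" for u
      using Ck_on_has_derivative[of 0 "coord c ` W" ?G u] der BW that
      by (auto intro: has_derivative_at_withinI)
    show "inj_on ?G (coord c ` B)"
    proof (rule inj_onI)
      fix u v assume uv: "u \<in> coord c ` B" "v \<in> coord c ` B" "?G u = ?G v"
      have "f (param c u) = f (param c v)"
        using inj_onD[OF inj_on_coord[OF d]] uv BW pW W(3) by (auto simp: image_subset_iff)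
      then have "param c u = param c v" using f by (auto dest: injD)
      then show "u = v" using uv pW BW coord_param by (metis subset_iff)
    qed
    show "?q (?G u) \<ge> 0" if "u \<in> coord c ` B" for u using that BW nn by auto
    show "(\<lambda>v. indicator (?G ` coord c ` B) v * ?q v) \<in> borel_measurable borel"
    proof -
      have "(\<lambda>v. indicator (?G ` coord c ` B) v * ?q v) =
          (\<lambda>v. indicator (coord d ` f ` B) v * (indicator (img d) v * ?q v))"
      proof -
        have "?G ` coord c ` B \<inter> img d = ?G ` coord c ` B" using GW BW by blast
        then show ?thesis unfolding GB
          by (metis (no_types, opaque_lifting) indicator_inter_arith mult.assoc)
      qed
      then show ?thesis using m_on sfB by simp
    qed
    show "(\<lambda>u. indicator (coord c ` B) u * (?D u * ?q (?G u))) \<in> borel_measurable borel"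
    proof -
      have "continuous_on (coord c ` W) (\<lambda>u. frechet_derivative ?G (at u) v)" for v
        using der by simp
      then have "continuous_on (coord c ` W) (\<lambda>u. matrix (frechet_derivative ?G (at u)))"
        unfolding matrix_def by (intro continuous_intros)
      then have 1: "?D \<in> borel_measurable (restrict_space borel (coord c ` W))"
        by (intro borel_measurable_continuous_on_restrict continuous_intros)
      have 2: "(\<lambda>u. indicator (img d) (?G u) * ?q (?G u)) \<in> borel_measurable (restrict_space borel (coord c ` W))"
        by (rule measurable_compose[OF borel_measurable_continuous_on_restrict[OF contG] m_on])
      have "(\<lambda>u. ?D u * (indicator (img d) (?G u) * ?q (?G u))) \<in> borel_measurable (restrict_space borel (coord c ` W))"
        by (intro borel_measurable_times 1 2)
      then have "(\<lambda>u. indicator (coord c ` W) u * (?D u * (indicator (img d) (?G u) * ?q (?G u)))) \<in> borel_measurable borel"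
        by (subst (asm) borel_measurable_restrict_space_iff) (use oW in auto)
      then have "(\<lambda>u. indicator (coord c ` B) u * (indicator (coord c ` W) u *
          (?D u * (indicator (img d) (?G u) * ?q (?G u))))) \<in> borel_measurable borel"
        using sB by measurable
      moreover have "indicator (coord c ` B) u * (indicator (coord c ` W) u *
          (?D u * (indicator (img d) (?G u) * ?q (?G u)))) = indicator (coord c ` B) u * (?D u * ?q (?G u))" for u
        using BW GW by (auto simp: indicator_def)
      ultimately show ?thesis by (simp only:)
    qed
  qed
  moreover have "(\<integral>\<^sup>+v\<in>?G ` (coord c ` B). ennreal (?q v) \<partial>lborel) =
      (\<integral>\<^sup>+v\<in>coord d ` f ` B. ennreal (vol_density g d (param d v)) * ennreal (k (param d v)) \<partial>lborel)"
    unfolding GB[symmetric]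
    using fBW vol_density_pos[OF d] param_coord[OF d] k(1)
    by (intro nn_integral_cong)
      (auto simp: indicator_def ennreal_mult less_imp_le subset_iff)
  moreover have "(\<integral>\<^sup>+u\<in>coord c ` B. ennreal (?D u * ?q (?G u)) \<partial>lborel) =
     (\<integral>\<^sup>+u\<in>coord c ` B. ennreal (?D u * (vol_density g d (f (param c u)) * k (f (param c u)))) \<partial>lborel)"
    by (intro nn_integral_cong) (use BW pW W(3) param_coord[OF d] in \<open>auto simp: indicator_def image_subset_iff subset_iff\<close>)
  ultimately show ?thesis by simp
qed

lemma chart_volume_compatible:
  assumes c: "c \<in> A" and d: "d \<in> A" and B: "B \<in> sets borel" "B \<subseteq> dom_of c \<inter> dom_of d"
  shows "emeasure (chart_volume c) B = emeasure (chart_volume d) B"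
proof -
  let ?W = "dom_of c \<inter> dom_of d"
  have "(\<integral>\<^sup>+v\<in>coord d ` id ` B. ennreal (vol_density g d (param d v)) * ennreal 1 \<partial>lborel) =
    (\<integral>\<^sup>+u\<in>coord c ` B. ennreal (\<bar>det (matrix (frechet_derivative (coord d \<circ> id \<circ> param c) (at u)))\<bar>
        * (vol_density g d (id (param c u)) * 1)) \<partial>lborel)"
  proof (rule nn_integral_chart_image[OF c d B(1,2)])
    show "Ck_on 1 (coord c ` ?W) (coord d \<circ> id \<circ> param c)"
      using transition_Ck[OF c d, of 1] by (simp only: o_id)
    show "open ?W" using open_dom c d by blast
  qed (use B in auto)
  also have "\<dots> = (\<integral>\<^sup>+u\<in>coord c ` B. ennreal (vol_density g c (param c u)) \<partial>lborel)"
    using B(2) param_coord[OF c]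
    by (intro nn_integral_cong) (auto simp: indicator_def vol_density_transition[OF c d] subset_iff)
  finally show ?thesis using B by (simp add: emeasure_chart_volume c d)
qed

text \<open>
  The defining condition of the Riemannian volume is satisfied by exactly one measure: existence is
  gluing along the atlas, uniqueness is locality of Borel measures.
\<close>

lemma riemannian_volume_works:
  "sets vol = sets borel \<and> (\<forall>c\<in>A. \<forall>B\<in>sets borel. B \<subseteq> dom_of c \<longrightarrow>
     emeasure vol B = (\<integral>\<^sup>+u\<in>coord c ` B. ennreal (vol_density g c (param c u)) \<partial>lborel))"
  unfolding riemannian_volume_def
proof (rule theI')
  let ?P = "\<lambda>\<mu>. sets \<mu> = sets borel \<and> (\<forall>c\<in>A. \<forall>B\<in>sets borel. B \<subseteq> dom_of c \<longrightarrow>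
     emeasure \<mu> B = (\<integral>\<^sup>+u\<in>coord c ` B. ennreal (vol_density g c (param c u)) \<partial>lborel))"
  have "\<exists>\<mu>. sets \<mu> = sets borel \<and>
      (\<forall>c\<in>A. \<forall>B\<in>sets borel. B \<subseteq> dom_of c \<longrightarrow> emeasure \<mu> B = emeasure (chart_volume c) B)"
    by (rule borel_measure_glue)
      (use open_dom charts_cover chart_volume_compatible sets_chart_volume in blast)+
  then obtain \<mu> where "sets \<mu> = sets borel"
      "\<And>c B. c \<in> A \<Longrightarrow> B \<in> sets borel \<Longrightarrow> B \<subseteq> dom_of c \<Longrightarrow> emeasure \<mu> B = emeasure (chart_volume c) B"
    by blast
  then have ex: "?P \<mu>" by (simp add: emeasure_chart_volume)
  have unique: "\<mu>1 = \<mu>2" if "?P \<mu>1" "?P \<mu>2" for \<mu>1 \<mu>2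
  proof (rule borel_measure_eqI_locally)
    fix p obtain c where "c \<in> A" "p \<in> dom_of c" by (rule chart_at)
    then show "\<exists>U. open U \<and> p \<in> U \<and> (\<forall>B\<in>sets borel. B \<subseteq> U \<longrightarrow> emeasure \<mu>1 B = emeasure \<mu>2 B)"
      using that open_dom by (intro exI[of _ "dom_of c"]) auto
  qed (use that in auto)
  show "\<exists>!\<mu>. ?P \<mu>"
    by (rule ex1I[of ?P, OF ex]) (rule unique[OF _ ex])
qed

lemma sets_vol [simp, measurable_cong]: "sets vol = sets borel"
  using riemannian_volume_works by simp

lemma space_vol [simp]: "space vol = UNIV"
  using sets_eq_imp_space_eq[OF sets_vol] by simp

lemma nn_integral_vol:
  assumes c: "c \<in> A" and q: "q \<in> borel_measurable borel" and B: "B \<subseteq> dom_of c" "B \<in> sets borel"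
  shows "(\<integral>\<^sup>+p\<in>B. q p \<partial>vol) =
    (\<integral>\<^sup>+u\<in>coord c ` B. ennreal (vol_density g c (param c u)) * q (param c u) \<partial>lborel)"
proof -
  have sB: "dom_of c \<in> sets borel" using open_dom[OF c] by simp
  have eq: "density vol (indicator (dom_of c)) = density (chart_volume c) (indicator (dom_of c))"
  proof (rule measure_eqI)
    fix E assume "E \<in> sets (density vol (indicator (dom_of c)))"
    then have E: "E \<in> sets borel" by simp
    have "emeasure vol (dom_of c \<inter> E) = emeasure (chart_volume c) (dom_of c \<inter> E)"
      using riemannian_volume_works c E sB by (simp add: emeasure_chart_volume)
    then show "emeasure (density vol (indicator (dom_of c))) E =
        emeasure (density (chart_volume c) (indicator (dom_of c))) E"
      using E sB by (simp add: emeasure_restricted)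
  qed simp
  have "(\<integral>\<^sup>+p. indicator (dom_of c) p * (q p * indicator B p) \<partial>vol) =
      (\<integral>\<^sup>+p. indicator (dom_of c) p * (q p * indicator B p) \<partial>chart_volume c)"
    using arg_cong[OF eq, of "\<lambda>M. \<integral>\<^sup>+p. q p * indicator B p \<partial>M"] q B(2) sB
    by (simp add: nn_integral_density)
  moreover have "indicator (dom_of c) p * (q p * indicator B p) = q p * indicator B p" for p
    using B(1) by (auto simp: indicator_def)
  ultimately show ?thesis using nn_integral_chart_volume[OF assms] by simp
qed

section \<open>Test functions determine continuous densities\<close>

lemma continuous_on_chartwiseI:
  fixes u :: "'a \<Rightarrow> 'b::topological_space"
  assumes "\<And>c. c \<in> A \<Longrightarrow> continuous_on (img c) (u \<circ> param c)"
  shows "continuous_on UNIV u"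
proof -
  have "continuous_on (dom_of c) u" if "c \<in> A" for c
  proof -
    have "continuous_on (dom_of c) ((u \<circ> param c) \<circ> coord c)"
      by (rule continuous_on_compose[OF continuous_on_coord[OF that] assms[OF that]])
    then show ?thesis by (simp add: param_coord[OF that] cong: continuous_on_cong)
  qed
  then have "isCont u p" for p
    by (metis chart_at continuous_on_eq_continuous_at open_dom)
  then show ?thesis by (simp add: continuous_at_imp_continuous_on)
qed

lemma Ck_fun_continuous: "Ck_fun A k u \<Longrightarrow> continuous_on UNIV u"
  unfolding Ck_fun_def by (rule continuous_on_chartwiseI, rule Ck_on_continuous, erule bspec)

text \<open>The Riemannian volume charges every nonempty open set.\<close>

lemma vol_open_null_imp_empty:
  assumes "open U" "AE p in vol. p \<notin> U"
  shows "U = {}"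
proof (rule ccontr)
  assume "U \<noteq> {}"
  then obtain p where p: "p \<in> U" by blast
  obtain c where c: "c \<in> A" "p \<in> dom_of c" by (rule chart_at)
  let ?V = "U \<inter> dom_of c"
  have V: "open ?V" "?V \<in> sets borel" using assms(1) open_dom[OF c(1)] by auto
  have oV: "open (coord c ` ?V)" using V(1) by (rule open_coord_image[OF c(1)]) simp
  have "emeasure vol ?V = 0"
  proof -
    have "AE q in vol. q \<notin> ?V" using assms(2) by eventually_elim simp
    then show ?thesis using V(2) AE_iff_null_sets[of ?V vol] by auto
  qed
  then have "(\<integral>\<^sup>+u\<in>coord c ` ?V. ennreal (vol_density g c (param c u)) \<partial>lborel) = 0"
    using riemannian_volume_works c(1) V(2) by simp
  moreover have "(\<lambda>u. ennreal (vol_density g c (param c u)) * indicator (coord c ` ?V) u) \<in> borel_measurable lborel"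
  proof -
    have [measurable]: "coord c ` ?V \<in> sets borel" using oV by simp
    have "(\<lambda>u. indicator (img c) u * vol_density g c (param c u)) \<in> borel_measurable borel"
      using measurable_vol_density[OF c(1)] open_img[OF c(1)]
      by (subst (asm) borel_measurable_restrict_space_iff) auto
    then have "(\<lambda>u. ennreal (indicator (img c) u * vol_density g c (param c u)) * indicator (coord c ` ?V) u)
        \<in> borel_measurable borel"
      by measurable
    moreover have "ennreal (indicator (img c) u * vol_density g c (param c u)) * indicator (coord c ` ?V) u =
        ennreal (vol_density g c (param c u)) * indicator (coord c ` ?V) u" for u
      by (auto simp: indicator_def)
    ultimately show ?thesis by simp
  qed
  ultimately have "AE u in lborel. ennreal (vol_density g c (param c u)) * indicator (coord c ` ?V) u = 0"
    by (simp add: nn_integral_0_iff_AE)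
  then have "AE u in lborel. u \<notin> coord c ` ?V"
  proof eventually_elim
    case (elim u)
    then show ?case
      using vol_density_pos[OF c(1), of "param c u"] param_coord[OF c(1)] by (auto simp: indicator_def ennreal_eq_0_iff)
  qed
  then have "coord c ` ?V \<in> null_sets lborel"
    using oV AE_iff_null_sets[of "coord c ` ?V" lborel] by simp
  then have "negligible (coord c ` ?V)"
    by (simp add: negligible_iff_null_sets null_sets_completionI)
  then have "coord c ` ?V = {}" using open_not_negligible[OF oV] by blast
  then show False using p c by auto
qed

lemma vol_compact_finite:
  assumes c: "c \<in> A" and K: "compact K" "K \<subseteq> dom_of c"
  shows "emeasure vol K < \<infinity>"
proof -
  have cK: "compact (coord c ` K)"
    by (rule compact_continuous_image[OF continuous_on_subset[OF continuous_on_coord[OF c] K(2)] K(1)])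
  have "continuous_on (coord c ` K) (\<lambda>u. vol_density g c (param c u))"
    by (rule continuous_on_subset[OF continuous_on_vol_density[OF c]]) (use K in auto)
  then have "bounded ((\<lambda>u. vol_density g c (param c u)) ` coord c ` K)"
    using cK compact_continuous_image compact_imp_bounded by blast
  then obtain C where "\<And>v. v \<in> (\<lambda>u. vol_density g c (param c u)) ` coord c ` K \<Longrightarrow> norm v \<le> C"
    unfolding bounded_iff by blast
  from this[OF imageI] have C: "vol_density g c (param c u) \<le> C" if "u \<in> coord c ` K" for u
    using that by (metis abs_le_D1 real_norm_def)
  have "emeasure vol K = (\<integral>\<^sup>+u\<in>coord c ` K. ennreal (vol_density g c (param c u)) \<partial>lborel)"
    using riemannian_volume_works c K(2) borel_closed[OF compact_imp_closed[OF K(1)]] by simp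
  also have "\<dots> \<le> (\<integral>\<^sup>+u. ennreal C * indicator (coord c ` K) u \<partial>lborel)"
    by (intro nn_integral_mono) (auto simp: indicator_def intro!: ennreal_leI C)
  also have "\<dots> = ennreal C * emeasure lborel (coord c ` K)"
    using borel_closed[OF compact_imp_closed[OF cK]] by (intro nn_integral_cmult_indicator) simp
  also have "\<dots> < \<infinity>"
    using emeasure_bounded_finite[OF compact_imp_bounded[OF cK]] by (simp add: ennreal_mult_less_top)
  finally show ?thesis .
qed

text \<open>
  The bump of a chart, extended by zero.  If the closed ball of radius \<open>r > 0\<close> about \<open>a\<close> lies in the
  coordinate image of the chart, the support is a compact subset of the chart domain, so that the
  extension is \<open>C\<^sup>2\<close> on the whole manifold; this uses that compact sets are closed.
\<close>

definition chart_bump :: "('a, 'n) chart \<Rightarrow> real ^ 'n \<Rightarrow> real \<Rightarrow> 'a \<Rightarrow> real" where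
  "chart_bump c a r p = (if p \<in> dom_of c then bump a r (coord c p) else 0)"

lemma compact_param_cball: "c \<in> A \<Longrightarrow> cball a r \<subseteq> img c \<Longrightarrow> compact (param c ` cball a r)"
  by (rule compact_continuous_image[OF continuous_on_subset[OF continuous_on_param] compact_cball])

lemma chart_bump_nonneg: "chart_bump c a r p \<ge> 0"
  by (simp add: chart_bump_def bump_nonneg)

lemma chart_bump_eq_0:
  assumes "c \<in> A" "r > 0" "p \<notin> param c ` cball a r"
  shows "chart_bump c a r p = 0"
proof (cases "p \<in> dom_of c")
  case True
  then have "coord c p \<notin> cball a r" using assms(3) param_coord[OF assms(1)] by (metis image_eqI)
  then have "\<not> bump a r (coord c p) > 0" using bump_pos_iff[OF assms(2), of a "coord c p"] by auto
  then show ?thesis using bump_nonneg[of a r "coord c p"] True by (simp add: chart_bump_def)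
qed (simp add: chart_bump_def)

lemma compact_support_chart_bump:
  assumes "c \<in> A" "r > 0" "cball a r \<subseteq> img c"
  shows "compact (closure {p. chart_bump c a r p \<noteq> 0})"
proof -
  let ?K = "param c ` cball a r"
  have K: "compact ?K" by (rule compact_param_cball[OF assms(1,3)])
  have "closure {p. chart_bump c a r p \<noteq> 0} \<subseteq> ?K"
    using chart_bump_eq_0[OF assms(1,2)] compact_imp_closed[OF K] by (intro closure_minimal) auto
  then have "closure {p. chart_bump c a r p \<noteq> 0} = ?K \<inter> closure {p. chart_bump c a r p \<noteq> 0}" by blast
  then show ?thesis using compact_Int_closed[OF K closed_closure] by metis
qed

lemma Ck_fun_chart_bump:
  assumes c: "c \<in> A" and r: "r > 0" "cball a r \<subseteq> img c"
  shows "Ck_fun A 2 (chart_bump c a r)"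
  unfolding Ck_fun_def
proof
  fix d assume d: "d \<in> A"
  let ?K = "param c ` cball a r" and ?\<Phi> = "chart_bump c a r \<circ> param d"
  let ?V1 = "coord d ` (dom_of d \<inter> dom_of c)" and ?V2 = "coord d ` (dom_of d - ?K)"
  have o1: "open ?V1" by (intro open_coord_image[OF d] open_Int open_dom c d) blast
  have o2: "open ?V2"
    by (intro open_coord_image[OF d] open_Diff open_dom d compact_imp_closed compact_param_cball[OF c r(2)])
      blast
  have "Ck_on 2 ?V1 (\<lambda>u. bump a r ((coord c \<circ> param d) u))"
    by (rule Ck_on_compose[OF o1 open_UNIV subset_UNIV transition_Ck[OF d c] Ck_on_bump])
  then have 1: "Ck_on 2 ?V1 ?\<Phi>"
    by (rule Ck_on_cong[OF o1, rotated]) (auto simp: chart_bump_def param_coord[OF d])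
  have 2: "Ck_on 2 ?V2 ?\<Phi>"
    by (rule Ck_on_cong[OF o2 _ Ck_on_const[of _ _ 0]])
      (auto simp: chart_bump_eq_0[OF c r(1)] param_coord[OF d])
  show "Ck_on 2 (img d) ?\<Phi>"
  proof (rule Ck_on_local)
    fix u assume "u \<in> img d"
    moreover have "?K \<subseteq> dom_of c" using r(2) param_dom by blast
    ultimately have "u \<in> ?V1 \<or> u \<in> ?V2" by blast
    then show "\<exists>T. open T \<and> u \<in> T \<and> Ck_on 2 T ?\<Phi>" using o1 o2 1 2 by blast
  qed
qed

lemma integrable_mult_chart_bump:
  assumes c: "c \<in> A" and r: "r > 0" "cball a r \<subseteq> img c" and k: "continuous_on UNIV k"
  shows "integrable vol (\<lambda>p. k p * chart_bump c a r p)"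
proof -
  let ?K = "param c ` cball a r"
  have K: "compact ?K" "?K \<subseteq> dom_of c" using compact_param_cball[OF c r(2)] r(2) param_dom by auto
  have cont: "continuous_on UNIV (\<lambda>p. k p * chart_bump c a r p)"
    by (intro continuous_intros k Ck_fun_continuous[OF Ck_fun_chart_bump[OF c r]])
  then have "bounded ((\<lambda>p. k p * chart_bump c a r p) ` ?K)"
    by (intro compact_imp_bounded compact_continuous_image[OF _ K(1)] continuous_on_subset[OF cont]) auto
  then obtain C where C: "\<And>p. p \<in> ?K \<Longrightarrow> norm (k p * chart_bump c a r p) \<le> C"
    by (force simp: bounded_iff)
  show ?thesis
  proof (rule integrableI_bounded_set[of ?K _ _ C])
    show "?K \<in> sets vol" using compact_imp_closed[OF K(1)] by simp
    show "(\<lambda>p. k p * chart_bump c a r p) \<in> borel_measurable vol"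
      using borel_measurable_continuous_onI[OF cont] by simp
    show "emeasure vol ?K < \<infinity>" by (rule vol_compact_finite[OF c K])
    show "AE p\<in>?K in vol. norm (k p * chart_bump c a r p) \<le> C" using C by auto
    show "AE p in vol. p \<notin> ?K \<longrightarrow> k p * chart_bump c a r p = 0"
      using chart_bump_eq_0[OF c r(1)] by auto
  qed
qed

lemma continuous_density_le:
  assumes k: "continuous_on UNIV k1" "continuous_on UNIV k2"
    and eq: "\<And>\<Phi>. Ck_fun A 2 \<Phi> \<Longrightarrow> compact (closure {p. \<Phi> p \<noteq> 0}) \<Longrightarrow>
      (\<integral>p. k1 p * \<Phi> p \<partial>vol) = (\<integral>p. k2 p * \<Phi> p \<partial>vol)"
  shows "k2 p \<le> k1 p"
proof (rule ccontr)
  assume less: "\<not> k2 p \<le> k1 p"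
  obtain c where c: "c \<in> A" "p \<in> dom_of c" by (rule chart_at)
  have "open {q. k1 q < k2 q}" using k by (rule open_Collect_less)
  then have V: "open (coord c ` ({q. k1 q < k2 q} \<inter> dom_of c))"
    using open_dom[OF c(1)] by (intro open_coord_image[OF c(1)]) auto
  have "coord c p \<in> coord c ` ({q. k1 q < k2 q} \<inter> dom_of c)" using less c by auto
  then obtain r where r: "r > 0" "cball (coord c p) r \<subseteq> coord c ` ({q. k1 q < k2 q} \<inter> dom_of c)"
    using V by (meson open_contains_cball)
  then have sub: "cball (coord c p) r \<subseteq> img c" by blast
  let ?\<Phi> = "chart_bump c (coord c p) r"
  note int = integrable_mult_chart_bump[OF c(1) r(1) sub]
  have nonneg: "0 \<le> (k2 q - k1 q) * ?\<Phi> q" for q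
  proof (cases "q \<in> param c ` cball (coord c p) r")
    case True
    then have "k1 q < k2 q" using r(2) param_coord[OF c(1)] by auto
    then show ?thesis by (simp add: chart_bump_nonneg)
  next
    case False then show ?thesis by (simp add: chart_bump_eq_0[OF c(1) r(1)])
  qed
  have "(\<integral>q. (k2 q - k1 q) * ?\<Phi> q \<partial>vol) = 0"
    using eq[OF Ck_fun_chart_bump compact_support_chart_bump, OF c(1) r(1) sub c(1) r(1) sub]
    by (simp add: left_diff_distrib int k)
  then have "AE q in vol. (k2 q - k1 q) * ?\<Phi> q = 0"
    using nonneg int[OF k(1)] int[OF k(2)]
    by (subst (asm) integral_nonneg_eq_0_iff_AE) (auto simp: left_diff_distrib)
  then have "AE q in vol. q \<notin> {q. 0 < (k2 q - k1 q) * ?\<Phi> q}"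
    by eventually_elim (simp only: mem_Collect_eq less_irrefl not_False_eq_True)
  moreover have "open {q. 0 < (k2 q - k1 q) * ?\<Phi> q}"
    by (intro open_Collect_less continuous_intros k Ck_fun_continuous[OF Ck_fun_chart_bump[OF c(1) r(1) sub]])
  ultimately have "{q. 0 < (k2 q - k1 q) * ?\<Phi> q} = {}" by (intro vol_open_null_imp_empty)
  moreover have "0 < (k2 p - k1 p) * ?\<Phi> p"
    using less c r(1) by (intro mult_pos_pos) (auto simp: chart_bump_def bump_pos_iff)
  ultimately show False by blast
qed

text \<open>
  Hence a continuous function with the duality property of the transferred density is the
  transferred density.
\<close>

lemma transfer_eqI:
  assumes "continuous_on UNIV k"
    and "\<And>\<Phi>. Ck_fun A 2 \<Phi> \<Longrightarrow> compact (closure {p. \<Phi> p \<noteq> 0}) \<Longrightarrow>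
      (\<integral>p. h p * \<Phi> (f p) \<partial>vol) = (\<integral>p. k p * \<Phi> p \<partial>vol)"
  shows "transfer A g f h = k"
  unfolding transfer_def
proof (rule the_equality)
  fix k' assume k': "continuous_on UNIV k' \<and> (\<forall>\<Phi>. Ck_fun A 2 \<Phi> \<and> compact (closure {p. \<Phi> p \<noteq> 0}) \<longrightarrow>
        (\<integral>p. h p * \<Phi> (f p) \<partial>vol) = (\<integral>p. k' p * \<Phi> p \<partial>vol))"
  show "k' = k"
  proof
    fix p show "k' p = k p"
      by (rule antisym; rule continuous_density_le) (use assms k' in auto)
  qed
qed (use assms in auto)

section \<open>The transfer operator in charts\<close>

lemma open_chart_preimage: "c \<in> A \<Longrightarrow> d \<in> A \<Longrightarrow> continuous_on UNIV f \<Longrightarrow> open (dom_of c \<inter> f -` dom_of d)"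
  by (intro open_Int open_vimage open_dom)

lemma continuous_on_vol_density_dom: "c \<in> A \<Longrightarrow> continuous_on (dom_of c) (vol_density g c)"
  using continuous_on_compose[OF continuous_on_coord continuous_on_vol_density]
  by (simp add: o_def param_coord cong: continuous_on_cong)

lemma chart_expr_C1:
  assumes "c \<in> A" "d \<in> A" "Ck_map A (Suc k) f"
  shows "Ck_on 1 (coord c ` (dom_of c \<inter> f -` dom_of d)) (coord d \<circ> f \<circ> param c)"
proof (rule Ck_on_mono)
  show "Ck_on (Suc k) (coord c ` (dom_of c \<inter> f -` dom_of d)) (coord d \<circ> f \<circ> param c)"
    using assms unfolding Ck_map_def by blast
qed simp

lemma chart_expr_has_derivative:
  assumes "c \<in> A" "d \<in> A" "Ck_map A (Suc k) f" "y \<in> dom_of c" "f y \<in> dom_of d"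
  shows "(coord d \<circ> f \<circ> param c has_derivative frechet_derivative (coord d \<circ> f \<circ> param c) (at (coord c y)))
    (at (coord c y))"
  using chart_expr_C1[OF assms(1-3)] unfolding One_nat_def
  by (rule Ck_on_has_derivative) (use assms(4,5) in auto)

lemma chart_expr_compose_has_derivative:
  assumes A: "c \<in> A" "d \<in> A" and f: "continuous_on UNIV f" and y: "y \<in> dom_of c" "f y \<in> dom_of d"
    and 1: "(coord d \<circ> f \<circ> param c has_derivative D1) (at (coord c y))"
    and 2: "(coord e \<circ> f' \<circ> param d has_derivative D2) (at (coord d (f y)))"
  shows "(coord e \<circ> (f' \<circ> f) \<circ> param c has_derivative D2 \<circ> D1) (at (coord c y))"
proof -
  let ?S = "coord c ` (dom_of c \<inter> f -` dom_of d)"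
  have "open ?S" by (intro open_coord_image open_chart_preimage A f) auto
  have "(coord d \<circ> f \<circ> param c) (coord c y) = coord d (f y)" by (simp add: param_coord A y)
  then have "((coord e \<circ> f' \<circ> param d) \<circ> (coord d \<circ> f \<circ> param c) has_derivative D2 \<circ> D1) (at (coord c y))"
    using 2 by (intro diff_chain_at 1) simp
  then show ?thesis
    by (rule has_derivative_transform_within_open[OF _ \<open>open ?S\<close>])
      (use A y in \<open>auto simp: param_coord\<close>)
qed

text \<open>
  The Jacobian of \<^term>\<open>f\<close> at \<^term>\<open>y\<close> with respect to the Riemannian volume, computed in a chart
  \<^term>\<open>c\<close> around \<^term>\<open>y\<close> and a chart \<^term>\<open>d\<close> around \<^term>\<open>f y\<close>.  It is taken in absolute value.
  The chain rule makes it multiplicative, and it equals one for the identity in any two charts; hence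
  it depends on neither chart.
\<close>

definition chart_jacobian ::
  "('a, 'n) chart \<Rightarrow> ('a, 'n) chart \<Rightarrow> ('a \<Rightarrow> 'a) \<Rightarrow> 'a \<Rightarrow> real" where
  "chart_jacobian c d f y =
     \<bar>det (matrix (frechet_derivative (coord d \<circ> f \<circ> param c) (at (coord c y))))\<bar>
     * vol_density g d (f y) / vol_density g c y"

lemma chart_jacobian_compose:
  assumes A: "c \<in> A" "d \<in> A" "e \<in> A" and f: "continuous_on UNIV f"
    and y: "y \<in> dom_of c" "f y \<in> dom_of d" "f' (f y) \<in> dom_of e"
    and 1: "(coord d \<circ> f \<circ> param c has_derivative D1) (at (coord c y))"
    and 2: "(coord e \<circ> f' \<circ> param d has_derivative D2) (at (coord d (f y)))"
  shows "chart_jacobian c e (f' \<circ> f) y = chart_jacobian d e f' (f y) * chart_jacobian c d f y"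
proof -
  have "frechet_derivative (coord e \<circ> (f' \<circ> f) \<circ> param c) (at (coord c y)) = D2 \<circ> D1"
    using frechet_derivative_at[OF chart_expr_compose_has_derivative[OF A(1,2) f y(1,2) 1 2]] by simp
  moreover have "det (matrix (D2 \<circ> D1)) = det (matrix D2) * det (matrix D1)"
    using 1 2 by (simp add: matrix_compose has_derivative_linear det_mul)
  moreover have "vol_density g d (f y) > 0" by (rule vol_density_pos[OF A(2) y(2)])
  ultimately show ?thesis
    using frechet_derivative_at[OF 1] frechet_derivative_at[OF 2]
    by (simp add: chart_jacobian_def abs_mult)
qed

lemma transition_id_has_derivative:
  assumes "c \<in> A" "d \<in> A" "p \<in> dom_of c" "p \<in> dom_of d"
  shows "(coord d \<circ> id \<circ> param c has_derivative frechet_derivative (coord d \<circ> id \<circ> param c) (at (coord c p)))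
    (at (coord c p))"
  using transition_has_derivative[OF assms] by (simp only: o_id)

lemma chart_jacobian_id:
  assumes "c \<in> A" "d \<in> A" "p \<in> dom_of c" "p \<in> dom_of d"
  shows "chart_jacobian c d id p = 1"
  using vol_density_pos[OF assms(1,3)]
  by (simp add: chart_jacobian_def comp_id vol_density_transition[OF assms, symmetric])

lemma chart_jacobian_indep:
  assumes c: "c \<in> A" "c' \<in> A" "y \<in> dom_of c" "y \<in> dom_of c'"
    and d: "d \<in> A" "d' \<in> A" "f y \<in> dom_of d" "f y \<in> dom_of d'" and f: "Ck_map A (Suc k) f"
  shows "chart_jacobian c d f y = chart_jacobian c' d' f y"
proof -
  have cont: "continuous_on UNIV f" using f by (simp add: Ck_map_def)
  note D = chart_expr_has_derivative[OF _ _ f]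
  have "chart_jacobian c' d (f \<circ> id) y = chart_jacobian c d f (id y) * chart_jacobian c' c id y"
    by (rule chart_jacobian_compose[OF _ _ _ _ _ _ _ transition_id_has_derivative D]) (use c d in auto)
  then have 1: "chart_jacobian c' d f y = chart_jacobian c d f y"
    using chart_jacobian_id[OF c(2,1,4,3)] by (simp add: o_id)
  have "chart_jacobian c' d' (id \<circ> f) y = chart_jacobian d d' id (f y) * chart_jacobian c' d f y"
    by (rule chart_jacobian_compose[OF _ _ _ cont _ _ _ D transition_id_has_derivative]) (use c d in auto)
  then have "chart_jacobian c' d' f y = chart_jacobian c' d f y"
    using chart_jacobian_id[OF d] by (simp add: id_o)
  with 1 show ?thesis by simp
qed

lemma chart_jacobian_pos:
  assumes c: "c \<in> A" "y \<in> dom_of c" and d: "d \<in> A" "f y \<in> dom_of d" and f: "Ck_diffeo A (Suc k) f"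
  shows "chart_jacobian c d f y > 0"
proof -
  have maps: "Ck_map A (Suc k) f" "Ck_map A (Suc k) (inv f)" and bij: "bij f"
    using f by (auto simp: Ck_diffeo_def)
  have inv: "inv f \<circ> f = id" using bij by (simp add: bij_is_inj)
  then have invy: "inv f (f y) = y" by (metis comp_apply id_apply)
  have "chart_jacobian c c (inv f \<circ> f) y = chart_jacobian d c (inv f) (f y) * chart_jacobian c d f y"
    by (rule chart_jacobian_compose[OF _ _ _ _ _ _ _
          chart_expr_has_derivative[OF _ _ maps(1)] chart_expr_has_derivative[OF _ _ maps(2)]])
      (use c d maps invy in \<open>auto simp: Ck_map_def\<close>)
  then have "chart_jacobian c d f y \<noteq> 0"
    using chart_jacobian_id[OF c(1,1,2,2)] unfolding inv by auto
  moreover have "chart_jacobian c d f y \<ge> 0"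
    using vol_density_pos[OF c] vol_density_pos[OF d] by (simp add: chart_jacobian_def)
  ultimately show ?thesis by simp
qed

text \<open>Some chart around a point.\<close>

definition chart_of :: "'a \<Rightarrow> ('a, 'n) chart" where
  "chart_of p = (SOME c. c \<in> A \<and> p \<in> dom_of c)"

lemma chart_of: "chart_of p \<in> A" "p \<in> dom_of (chart_of p)"
proof -
  obtain c where "c \<in> A \<and> p \<in> dom_of c" using chart_at[of p] by metis
  then have "chart_of p \<in> A \<and> p \<in> dom_of (chart_of p)" unfolding chart_of_def by (rule someI)
  then show "chart_of p \<in> A" "p \<in> dom_of (chart_of p)" by auto
qed

text \<open>The common value of the chart Jacobians, as a function on the manifold.\<close>

definition jacobian :: "('a \<Rightarrow> 'a) \<Rightarrow> 'a \<Rightarrow> real" where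
  "jacobian f y = chart_jacobian (chart_of y) (chart_of (f y)) f y"

lemma jacobian_eq:
  "c \<in> A \<Longrightarrow> d \<in> A \<Longrightarrow> y \<in> dom_of c \<Longrightarrow> f y \<in> dom_of d \<Longrightarrow> Ck_map A (Suc k) f \<Longrightarrow>
   jacobian f y = chart_jacobian c d f y"
  unfolding jacobian_def by (rule chart_jacobian_indep) (auto intro: chart_of)

lemma jacobian_pos: "Ck_diffeo A (Suc k) f \<Longrightarrow> jacobian f y > 0"
  unfolding jacobian_def by (rule chart_jacobian_pos) (auto intro: chart_of)

lemma continuous_on_jacobian:
  assumes f: "Ck_map A (Suc k) f" shows "continuous_on UNIV (jacobian f)"
proof -
  have cont: "continuous_on UNIV f" using f by (simp add: Ck_map_def)
  have "isCont (jacobian f) y" for y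
  proof -
    let ?c = "chart_of y" and ?d = "chart_of (f y)"
    let ?W = "dom_of ?c \<inter> f -` dom_of ?d" and ?G = "coord ?d \<circ> f \<circ> param ?c"
    have W: "open ?W" "y \<in> ?W" using open_chart_preimage[OF chart_of(1) chart_of(1) cont] chart_of by auto
    have "Ck_on 1 (coord ?c ` ?W) ?G"
      by (rule chart_expr_C1[OF chart_of(1) chart_of(1) f])
    then have "continuous_on (coord ?c ` ?W) (\<lambda>u. frechet_derivative ?G (at u) v)" for v
      by simp
    then have D: "continuous_on (coord ?c ` ?W) (\<lambda>u. \<bar>det (matrix (frechet_derivative ?G (at u)))\<bar>)"
      unfolding matrix_def by (intro continuous_intros)
    have cont_chart: "continuous_on ?W (chart_jacobian ?c ?d f)"
      unfolding chart_jacobian_def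
    proof (intro continuous_on_divide continuous_on_mult)
      show "continuous_on ?W (\<lambda>y. \<bar>det (matrix (frechet_derivative ?G (at (coord ?c y))))\<bar>)"
        by (rule continuous_on_compose2[OF D continuous_on_subset[OF continuous_on_coord[OF chart_of(1)]]]) auto
      show "continuous_on ?W (\<lambda>y. vol_density g ?d (f y))"
        by (rule continuous_on_compose2[OF continuous_on_vol_density_dom[OF chart_of(1)] continuous_on_subset[OF cont]]) auto
      show "continuous_on ?W (vol_density g ?c)"
        by (rule continuous_on_subset[OF continuous_on_vol_density_dom[OF chart_of(1)]]) auto
      show "\<forall>y\<in>?W. vol_density g ?c y \<noteq> 0"
        using vol_density_pos[OF chart_of(1)] by fastforce
    qed
    have eq: "jacobian f z = chart_jacobian ?c ?d f z" if "z \<in> ?W" for z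
      by (rule jacobian_eq[OF chart_of(1) chart_of(1) _ _ f]) (use that in auto)
    have "continuous_on ?W (jacobian f)"
      by (rule iffD2[OF continuous_on_cong[OF refl] cont_chart]) (rule eq)
    then show ?thesis using W by (simp add: continuous_on_eq_continuous_at)
  qed
  then show ?thesis by (simp add: continuous_at_imp_continuous_on)
qed

text \<open>The density, with respect to the volume, of the image of \<open>h dvol\<close> under the bijection \<^term>\<open>f\<close>.\<close>

definition pushforward :: "('a \<Rightarrow> 'a) \<Rightarrow> ('a \<Rightarrow> real) \<Rightarrow> 'a \<Rightarrow> real" where
  "pushforward f h p = h (inv f p) / jacobian f (inv f p)"

lemma continuous_on_pushforward:
  assumes f: "Ck_diffeo A (Suc k) f" and h: "continuous_on UNIV h"
  shows "continuous_on UNIV (pushforward f h)"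
proof -
  have "Ck_map A (Suc k) f" "continuous_on UNIV (inv f)" using f by (auto simp: Ck_diffeo_def Ck_map_def)
  then show ?thesis
    unfolding pushforward_def using jacobian_pos[OF f] less_imp_neq
    by (intro continuous_on_divide continuous_on_compose2[OF h] continuous_on_compose2[OF continuous_on_jacobian])
      (auto simp: less_imp_neq[symmetric])
qed

lemma distr_density_eq_pushforward:
  assumes f: "Ck_diffeo A (Suc k) f" and h: "continuous_on UNIV h" "\<And>p. h p \<ge> 0"
  shows "distr (density vol (\<lambda>p. ennreal (h p))) borel f = density vol (\<lambda>p. ennreal (pushforward f h p))"
proof (rule borel_measure_eqI_locally)
  have map: "Ck_map A (Suc k) f" and cont: "continuous_on UNIV f" "continuous_on UNIV (inv f)" and bij: "bij f"
    using f by (auto simp: Ck_diffeo_def Ck_map_def)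
  have inv [simp]: "inv f (f y) = y" "f (inv f p) = p" for y p
    using bij by (auto simp: bij_is_inj bij_is_surj surj_f_inv_f)
  have push: "continuous_on UNIV (pushforward f h)" by (rule continuous_on_pushforward[OF f h(1)])
  have push0: "pushforward f h p \<ge> 0" for p
    unfolding pushforward_def using h(2) jacobian_pos[OF f] by (simp add: less_imp_le)
  have [measurable]: "f \<in> borel_measurable borel" "h \<in> borel_measurable borel" "pushforward f h \<in> borel_measurable borel"
    using cont(1) h(1) push by (auto intro: borel_measurable_continuous_onI)
  fix p
  define y where "y = inv f p"
  let ?c = "chart_of y" and ?d = "chart_of p"
  let ?W = "dom_of ?c \<inter> f -` dom_of ?d"
  have oW: "open ?W" by (rule open_chart_preimage[OF chart_of(1) chart_of(1) cont(1)])
  have "f ` ?W = inv f -` ?W"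
  proof (intro set_eqI iffI)
    fix q assume "q \<in> inv f -` ?W"
    then show "q \<in> f ` ?W" by (intro image_eqI[of q f "inv f q"]) auto
  qed auto
  then have ofW: "open (f ` ?W)" using open_vimage[OF oW cont(2)] by simp
  have "y \<in> ?W" using chart_of by (auto simp: y_def)
  then have pW: "p \<in> f ` ?W" by (metis inv(2) image_eqI y_def)
  have "emeasure (distr (density vol (\<lambda>p. ennreal (h p))) borel f) B =
      emeasure (density vol (\<lambda>p. ennreal (pushforward f h p))) B"
    if B: "B \<in> sets borel" "B \<subseteq> f ` ?W" for B
  proof -
    let ?B0 = "f -` B"
    have B0: "?B0 \<in> sets borel" using B(1) measurable_sets_borel[of f borel B] by simp
    have B0W: "?B0 \<subseteq> ?W"
    proof
      fix z assume "z \<in> ?B0"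
      then obtain w where "w \<in> ?W" "f z = f w" using B(2) by blast
      then show "z \<in> ?W" by (metis inv(1))
    qed
    have fB0: "f ` ?B0 = B" using bij by (simp add: bij_is_surj surj_image_vimage_eq)
    have "emeasure (distr (density vol (\<lambda>p. ennreal (h p))) borel f) B = (\<integral>\<^sup>+z\<in>?B0. ennreal (h z) \<partial>vol)"
      using B(1) B0 by (simp add: emeasure_distr emeasure_density)
    also have "\<dots> = (\<integral>\<^sup>+u\<in>coord ?c ` ?B0. ennreal (vol_density g ?c (param ?c u)) * ennreal (h (param ?c u)) \<partial>lborel)"
      by (rule nn_integral_vol[OF chart_of(1)]) (use B0 B0W in auto)
    also have "\<dots> = (\<integral>\<^sup>+u\<in>coord ?c ` ?B0. ennreal (\<bar>det (matrix (frechet_derivative (coord ?d \<circ> f \<circ> param ?c) (at u)))\<bar>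
        * (vol_density g ?d (f (param ?c u)) * pushforward f h (f (param ?c u)))) \<partial>lborel)"
    proof (rule nn_integral_cong)
      fix u
      show "ennreal (vol_density g ?c (param ?c u)) * ennreal (h (param ?c u)) * indicator (coord ?c ` ?B0) u =
          ennreal (\<bar>det (matrix (frechet_derivative (coord ?d \<circ> f \<circ> param ?c) (at u)))\<bar>
          * (vol_density g ?d (f (param ?c u)) * pushforward f h (f (param ?c u)))) * indicator (coord ?c ` ?B0) u"
      proof (cases "u \<in> coord ?c ` ?B0")
        case True
        then obtain z where z: "z \<in> ?B0" "u = coord ?c z" by blast
        have zW: "z \<in> dom_of ?c" "f z \<in> dom_of ?d" using z B0W by auto
        have "jacobian f z = chart_jacobian ?c ?d f z"
          by (rule jacobian_eq[OF chart_of(1) chart_of(1) zW map])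
        moreover have "jacobian f z > 0" "vol_density g ?c z > 0"
          using jacobian_pos[OF f] vol_density_pos[OF chart_of(1) zW(1)] by auto
        ultimately have "vol_density g ?c z * h z = \<bar>det (matrix (frechet_derivative (coord ?d \<circ> f \<circ> param ?c) (at u)))\<bar>
            * (vol_density g ?d (f z) * pushforward f h (f z))"
          by (simp add: pushforward_def chart_jacobian_def z(2) field_simps)
        then show ?thesis
          using \<open>vol_density g ?c z > 0\<close> h(2)
          by (simp add: z(2) param_coord[OF chart_of(1) zW(1)] ennreal_mult[symmetric] less_imp_le)
      qed simp
    qed
    also have "\<dots> = (\<integral>\<^sup>+v\<in>coord ?d ` f ` ?B0. ennreal (vol_density g ?d (param ?d v)) * ennreal (pushforward f h (param ?d v)) \<partial>lborel)"
    proof (rule nn_integral_chart_image[OF chart_of(1) chart_of(1) B0 B0W _ oW, symmetric])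
      show "Ck_on 1 (coord ?c ` ?W) (coord ?d \<circ> f \<circ> param ?c)"
        by (rule chart_expr_C1[OF chart_of(1) chart_of(1) map])
      show "inj f" using bij by (rule bij_is_inj)
    qed (use B(1) fB0 push0 in auto)
    also have "\<dots> = (\<integral>\<^sup>+q\<in>B. ennreal (pushforward f h q) \<partial>vol)"
      unfolding fB0 by (rule nn_integral_vol[OF chart_of(1), symmetric]) (use B in auto)
    also have "\<dots> = emeasure (density vol (\<lambda>p. ennreal (pushforward f h p))) B"
      using B(1) by (simp add: emeasure_density)
    finally show ?thesis .
  qed
  then show "\<exists>U. open U \<and> p \<in> U \<and> (\<forall>B\<in>sets borel. B \<subseteq> U \<longrightarrow>
      emeasure (distr (density vol (\<lambda>p. ennreal (h p))) borel f) B =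
      emeasure (density vol (\<lambda>p. ennreal (pushforward f h p))) B)"
    using ofW pW by blast
qed simp_all

theorem transfer_eq_pushforward:
  assumes f: "Ck_diffeo A (Suc k) f" and h: "continuous_on UNIV h" "\<And>p. h p \<ge> 0"
  shows "transfer A g f h = pushforward f h"
proof (rule transfer_eqI)
  show push: "continuous_on UNIV (pushforward f h)" by (rule continuous_on_pushforward[OF f h(1)])
  fix \<Phi> assume "Ck_fun A 2 \<Phi>"
  then have \<Phi>: "continuous_on UNIV \<Phi>" by (rule Ck_fun_continuous)
  have cont: "continuous_on UNIV f" using f by (auto simp: Ck_diffeo_def Ck_map_def)
  have [measurable]: "f \<in> borel_measurable borel" "h \<in> borel_measurable borel"
      "pushforward f h \<in> borel_measurable borel" "\<Phi> \<in> borel_measurable borel"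
    using cont h(1) push \<Phi> by (auto intro: borel_measurable_continuous_onI)
  have push0: "pushforward f h p \<ge> 0" for p
    unfolding pushforward_def using h(2) jacobian_pos[OF f] by (simp add: less_imp_le)
  have "(\<integral>p. h p * \<Phi> (f p) \<partial>vol) = (\<integral>p. \<Phi> (f p) \<partial>density vol (\<lambda>p. ennreal (h p)))"
    using h(2) by (subst integral_density) auto
  also have "\<dots> = (\<integral>p. \<Phi> p \<partial>distr (density vol (\<lambda>p. ennreal (h p))) borel f)"
    by (subst integral_distr) auto
  also have "\<dots> = (\<integral>p. \<Phi> p \<partial>density vol (\<lambda>p. ennreal (pushforward f h p)))"
    by (simp only: distr_density_eq_pushforward[OF f h])
  also have "\<dots> = (\<integral>p. pushforward f h p * \<Phi> p \<partial>vol)"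
    using push0 by (subst integral_density) auto
  finally show "(\<integral>p. h p * \<Phi> (f p) \<partial>vol) = (\<integral>p. pushforward f h p * \<Phi> p \<partial>vol)" .
qed

end

section \<open>Curves of maps through the identity in Euclidean space\<close>

text \<open>
  Joint continuity of the velocity makes the convergence of the difference quotients uniform near
  the base point.  The derivatives along moving points and the spatial
  derivative of the velocity both rest on this estimate.
\<close>

lemma C1_C0_difference_quotient:
  fixes F :: "real \<Rightarrow> 'b::euclidean_space \<Rightarrow> 'c::real_normed_vector"
  assumes F: "C1_C0_on W F" and W: "open W" "(0, a) \<in> W"
    and D: "((\<lambda>s. F s a) has_vector_derivative D) (at 0)" and "e > 0"
  obtains d where "d > 0"
    "\<And>s u. \<bar>s\<bar> < d \<Longrightarrow> dist u a < d \<Longrightarrow> (s, u) \<in> W \<and> norm (F s u - F 0 u - s *\<^sub>R D) \<le> e * \<bar>s\<bar>"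
proof -
  obtain F' where F': "continuous_on W (\<lambda>(s, u). F' s u)"
      and der: "\<And>s u. (s, u) \<in> W \<Longrightarrow> ((\<lambda>s. F s u) has_vector_derivative F' s u) (at s)"
    using F by (force simp: C1_C0_on_def)
  have "F' 0 a = D" using der[OF W(2)] D by (rule vector_derivative_unique_at)
  obtain d1 where d1: "d1 > 0" "ball (0, a) d1 \<subseteq> W" using W by (meson open_contains_ball)
  have "continuous (at (0, a)) (\<lambda>(s, u). F' s u)"
    using F' W by (simp add: continuous_on_eq_continuous_at)
  then obtain d2 where d2: "d2 > 0"
      "\<And>z. dist z (0, a) < d2 \<Longrightarrow> dist ((\<lambda>(s, u). F' s u) z) ((\<lambda>(s, u). F' s u) (0, a)) < e"
    unfolding continuous_at_eps_delta using \<open>e > 0\<close> by blast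
  define d where "d = min d1 d2 / 2"
  have d: "d > 0" using d1 d2 by (simp add: d_def)
  have near: "(s, u) \<in> W" "norm (F' s u - D) \<le> e" if "\<bar>s\<bar> < d" "dist u a < d" for s u
  proof -
    have "dist (s, u) (0, a) \<le> \<bar>s\<bar> + dist u a"
      unfolding dist_Pair_Pair using sqrt_sum_squares_le_sum_abs[of "dist s 0" "dist u a"] by simp
    then have *: "dist (s, u) (0, a) < min d1 d2" using that by (simp add: d_def)
    then show "(s, u) \<in> W" using d1(2) by (auto simp: dist_commute)
    show "norm (F' s u - D) \<le> e"
      using d2(2)[of "(s, u)"] * \<open>F' 0 a = D\<close> by (simp add: dist_norm)
  qed
  have "norm (F s u - F 0 u - s *\<^sub>R D) \<le> e * \<bar>s\<bar>" if "\<bar>s\<bar> < d" "dist u a < d" for s u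
  proof -
    have "norm ((F s u - s *\<^sub>R D) - (F 0 u - 0 *\<^sub>R D)) \<le> e * norm (s - 0)"
    proof (rule differentiable_bound[where S = "ball 0 d" and f' = "\<lambda>t h. h *\<^sub>R (F' t u - D)"])
      fix t :: real assume "t \<in> ball 0 d"
      then have t: "\<bar>t\<bar> < d" by simp
      have "((\<lambda>t. F t u - t *\<^sub>R D) has_vector_derivative F' t u - D) (at t)"
        using der[OF near(1)[OF t that(2)]] by (auto intro!: derivative_eq_intros)
      then show "((\<lambda>t. F t u - t *\<^sub>R D) has_derivative (\<lambda>h. h *\<^sub>R (F' t u - D))) (at t within ball 0 d)"
        unfolding has_vector_derivative_def by (rule has_derivative_at_withinI)
      show "onorm (\<lambda>h. h *\<^sub>R (F' t u - D)) \<le> e"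
        by (rule onorm_le) (use near(2)[OF t that(2)] in \<open>simp add: mult.commute[of e] mult_left_mono\<close>)
    qed (use that in auto)
    then show ?thesis by (simp add: algebra_simps)
  qed
  with near(1) d show ?thesis using that by blast
qed

text \<open>
  If \<^term>\<open>F 0\<close> is constant, moving the argument along a path that is merely continuous at \<open>0\<close> does
  not change the velocity at \<open>0\<close>.
\<close>

lemma C1_C0_along_path:
  fixes F :: "real \<Rightarrow> 'b::euclidean_space \<Rightarrow> 'c::real_normed_vector"
  assumes F: "C1_C0_on W F" and W: "open W" "(0, a) \<in> W"
    and D: "((\<lambda>s. F s a) has_vector_derivative D) (at 0)"
    and const: "\<And>u. (0, u) \<in> W \<Longrightarrow> F 0 u = F 0 a"
    and y: "isCont y 0" "y 0 = a"
  shows "((\<lambda>s. F s (y s)) has_vector_derivative D) (at 0)"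
  unfolding has_vector_derivative_def has_derivative_at_alt
proof (intro conjI allI impI)
  fix e :: real assume "e > 0"
  from C1_C0_difference_quotient[OF F W D this]
  obtain d where d: "d > 0" "\<And>s u. \<bar>s\<bar> < d \<Longrightarrow> dist u a < d \<Longrightarrow>
      (s, u) \<in> W \<and> norm (F s u - F 0 u - s *\<^sub>R D) \<le> e * \<bar>s\<bar>" by blast
  obtain d' where d': "d' > 0" "\<And>s. dist s 0 < d' \<Longrightarrow> dist (y s) a < d"
    using y d(1) unfolding continuous_at_eps_delta by metis
  have "norm (F s (y s) - F 0 (y 0) - (s - 0) *\<^sub>R D) \<le> e * norm (s - 0)" if "norm (s - 0) < min d d'" for s
  proof -
    have "dist (y s) a < d" using d'(2)[of s] that by simp
    moreover have "F 0 (y s) = F 0 a"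
      by (rule const) (use d(2)[of 0 "y s"] \<open>dist (y s) a < d\<close> d(1) in auto)
    ultimately show ?thesis using d(2)[of s "y s"] that y(2) by simp
  qed
  then show "\<exists>d>0. \<forall>s. norm (s - 0) < d \<longrightarrow>
      norm (F s (y s) - F 0 (y 0) - (s - 0) *\<^sub>R D) \<le> e * norm (s - 0)"
    using d(1) d'(1) by (intro exI[of _ "min d d'"]) auto
qed (rule bounded_linear_scaleR_left)

text \<open>
  If \<^term>\<open>F 0\<close> is the identity, the equation \<^term>\<open>F s u = a\<close> has, for small \<^term>\<open>s\<close>, a solution
  near \<^term>\<open>a\<close>: this is Brouwer's theorem for \<^term>\<open>\<lambda>u. u - F s u + a\<close> on a small ball.
\<close>

lemma solve_near_identity:
  fixes F :: "real \<Rightarrow> 'b::euclidean_space \<Rightarrow> 'b"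
  assumes F: "C1_C0_on W F" and W: "open W" "(0, a) \<in> W"
    and D: "((\<lambda>s. F s a) has_vector_derivative D) (at 0)"
    and id: "\<And>u. (0, u) \<in> W \<Longrightarrow> F 0 u = u" and "r > 0"
  obtains d where "d > 0" "\<And>s. \<bar>s\<bar> < d \<Longrightarrow> \<exists>u. dist u a \<le> r \<and> (s, u) \<in> W \<and> F s u = a"
proof -
  from C1_C0_difference_quotient[OF F W D, of 1]
  obtain d where d: "d > 0" "\<And>s u. \<bar>s\<bar> < d \<Longrightarrow> dist u a < d \<Longrightarrow>
      (s, u) \<in> W \<and> norm (F s u - F 0 u - s *\<^sub>R D) \<le> \<bar>s\<bar>" by auto
  define \<rho> where "\<rho> = min r (d / 2)"
  have \<rho>: "\<rho> > 0" "\<rho> \<le> r" "\<rho> < d" using d(1) \<open>r > 0\<close> by (auto simp: \<rho>_def)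
  define \<delta> where "\<delta> = min d (\<rho> / (1 + norm D))"
  have D0: "1 + norm D > 0" by (rule add_pos_nonneg) auto
  have "\<delta> > 0" using d(1) \<rho>(1) D0 by (simp add: \<delta>_def)
  moreover have "\<exists>u. dist u a \<le> r \<and> (s, u) \<in> W \<and> F s u = a" if s: "\<bar>s\<bar> < \<delta>" for s
  proof -
    have sd: "\<bar>s\<bar> < d" and s\<rho>: "\<bar>s\<bar> * (1 + norm D) \<le> \<rho>"
      using s D0 by (auto simp: \<delta>_def pos_less_divide_eq less_imp_le)
    have inW: "(s, u) \<in> W" and small: "norm (F s u - u) \<le> \<rho>" if "dist u a \<le> \<rho>" for u
    proof -
      have u: "dist u a < d" using that \<rho>(3) by simp
      show "(s, u) \<in> W" using d(2)[OF sd u] by simp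
      have "F 0 u = u" using d(2)[of 0 u] d(1) u by (intro id) simp
      then have "norm (F s u - u - s *\<^sub>R D) \<le> \<bar>s\<bar>" using d(2)[OF sd u] by simp
      moreover have "norm (F s u - u) \<le> norm (F s u - u - s *\<^sub>R D) + norm (s *\<^sub>R D)"
        using norm_triangle_ineq[of "F s u - u - s *\<^sub>R D" "s *\<^sub>R D"] by simp
      ultimately show "norm (F s u - u) \<le> \<rho>" using s\<rho> by (simp add: algebra_simps)
    qed
    have "continuous_on W (\<lambda>(s, u). F s u)" using F by (simp add: C1_C0_on_def)
    then have "continuous_on (cball a \<rho>) (\<lambda>u. (\<lambda>(s, u). F s u) (s, u))"
      by (rule continuous_on_compose2) (use inW in \<open>auto intro!: continuous_intros simp: dist_commute\<close>)
    then have "continuous_on (cball a \<rho>) (\<lambda>u. u - F s u + a)"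
      by (intro continuous_intros) simp
    moreover have "(\<lambda>u. u - F s u + a) \<in> cball a \<rho> \<rightarrow> cball a \<rho>"
      using small by (auto simp: dist_norm norm_minus_commute)
    ultimately obtain u where "u \<in> cball a \<rho>" "u - F s u + a = u"
      using brouwer_ball[OF \<rho>(1)] by blast
    then show ?thesis using inW[of u] \<rho>(2) by (intro exI[of _ u]) (auto simp: dist_commute algebra_simps)
  qed
  ultimately show ?thesis using that by blast
qed

text \<open>
  If \<^term>\<open>F 0\<close> is the identity, the solutions of \<^term>\<open>F s (y s) = a\<close> start with the negative of
  the velocity of \<open>s \<mapsto> F s a\<close>; only continuity of
  \<^term>\<open>y\<close> at \<open>0\<close> has to be known beforehand.
\<close>

lemma solution_path_derivative:
  fixes F :: "real \<Rightarrow> 'b::euclidean_space \<Rightarrow> 'b"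
  assumes F: "C1_C0_on W F" and W: "open W" "(0, a) \<in> W"
    and D: "((\<lambda>s. F s a) has_vector_derivative D) (at 0)"
    and id: "\<And>u. (0, u) \<in> W \<Longrightarrow> F 0 u = u"
    and y: "isCont y 0" "y 0 = a" and sol: "\<forall>\<^sub>F s in nhds 0. F s (y s) = a"
  shows "(y has_vector_derivative - D) (at 0)"
  unfolding has_vector_derivative_def has_derivative_at_alt
proof (intro conjI allI impI)
  fix e :: real assume "e > 0"
  from C1_C0_difference_quotient[OF F W D this]
  obtain d where d: "d > 0" "\<And>s u. \<bar>s\<bar> < d \<Longrightarrow> dist u a < d \<Longrightarrow>
      (s, u) \<in> W \<and> norm (F s u - F 0 u - s *\<^sub>R D) \<le> e * \<bar>s\<bar>" by blast
  obtain d' where d': "d' > 0" "\<And>s. dist s 0 < d' \<Longrightarrow> dist (y s) a < d"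
    using y d(1) unfolding continuous_at_eps_delta by metis
  obtain d'' where d'': "d'' > 0" "\<And>s. dist s 0 < d'' \<Longrightarrow> F s (y s) = a"
    using sol unfolding eventually_nhds_metric by blast
  have "norm (y s - y 0 - (s - 0) *\<^sub>R (- D)) \<le> e * norm (s - 0)" if "norm (s - 0) < min d (min d' d'')" for s
  proof -
    have ys: "dist (y s) a < d" using d'(2)[of s] that by simp
    have "F 0 (y s) = y s" using d(2)[of 0 "y s"] ys d(1) by (intro id) auto
    then have "norm (a - y s - s *\<^sub>R D) \<le> e * \<bar>s\<bar>" using d(2)[of s "y s"] ys that d''(2)[of s] by simp
    moreover have "norm (y s - y 0 - (s - 0) *\<^sub>R (- D)) = norm (a - y s - s *\<^sub>R D)"
      using norm_minus_cancel[of "a - y s - s *\<^sub>R D"] y(2) by (simp add: algebra_simps)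
    ultimately show ?thesis by simp
  qed
  then show "\<exists>d>0. \<forall>s. norm (s - 0) < d \<longrightarrow> norm (y s - y 0 - (s - 0) *\<^sub>R (- D)) \<le> e * norm (s - 0)"
    using d(1) d'(1) d''(1) by (intro exI[of _ "min d (min d' d'')"]) auto
qed (rule bounded_linear_scaleR_left)

text \<open>
  The two derivatives may be interchanged: the velocity field is differentiable, and its spatial
  derivative is the velocity of the spatial derivatives.
\<close>

lemma velocity_field_has_derivative:
  fixes F :: "real \<Rightarrow> 'b::euclidean_space \<Rightarrow> 'b"
  assumes F: "C1_Ck_on (Suc k) W F" and W: "open W" "(0, a) \<in> W"
    and id: "\<And>u. (0, u) \<in> W \<Longrightarrow> F 0 u = u"
    and X: "\<And>u. (0, u) \<in> W \<Longrightarrow> ((\<lambda>s. F s u) has_vector_derivative X u) (at 0)"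
  obtains E where "(X has_derivative E) (at a)"
    "\<And>b. b \<in> Basis \<Longrightarrow> ((\<lambda>s. frechet_derivative (F s) (at a) b) has_vector_derivative E b) (at 0)"
proof -
  let ?G = "\<lambda>b s u. frechet_derivative (F s) (at u) b"
  have G: "C1_C0_on W (?G b)" for b using F by (cases k) auto
  have diff: "(F s has_derivative frechet_derivative (F s) (at u)) (at u)" if "(s, u) \<in> W" for s u
    using F that by (force simp: frechet_derivative_works[symmetric])
  have "\<exists>D. ((\<lambda>s. ?G b s a) has_vector_derivative D) (at 0)" for b
    using G[of b] W(2) by (force simp: C1_C0_on_def)
  then obtain E0 where E0: "\<And>b. ((\<lambda>s. ?G b s a) has_vector_derivative E0 b) (at 0)" by metis
  define E where "E v = (\<Sum>b\<in>Basis. (v \<bullet> b) *\<^sub>R E0 b)" for v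
  have E_Basis: "E b = E0 b" if "b \<in> Basis" for b
  proof -
    have "E b = (\<Sum>b'\<in>Basis. if b' = b then E0 b' else 0)"
      unfolding E_def using that by (intro sum.cong) (auto simp: inner_Basis)
    then show ?thesis using that by simp
  qed
  have E: "bounded_linear E"
    unfolding E_def by (intro bounded_linear_sum bounded_linear_scaleR_const bounded_linear_inner_left)
  have G0: "?G b 0 u = b" if "(0, u) \<in> W" for b u
  proof -
    have "open {u. (0, u) \<in> W}"
      using open_vimage[OF W(1), of "Pair 0"] by (simp add: vimage_def continuous_intros)
    then have "(F 0 has_derivative (\<lambda>v. v)) (at u)"
      by (rule has_derivative_transform_within_open[OF has_derivative_ident]) (use that id in auto)
    then show ?thesis using frechet_derivative_at by metis
  qed
  have "(X has_derivative E) (at a)"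
    unfolding has_derivative_at_alt
  proof (intro conjI allI impI E)
    fix e :: real assume e: "e > 0"
    define e' where "e' = e / DIM('b)"
    have e': "e' > 0" using e by (simp add: e'_def)
    have "\<exists>d>0. \<forall>s u. \<bar>s\<bar> < d \<longrightarrow> dist u a < d \<longrightarrow>
        (s, u) \<in> W \<and> norm (?G b s u - ?G b 0 u - s *\<^sub>R E0 b) \<le> e' * \<bar>s\<bar>" for b
      using C1_C0_difference_quotient[OF G W E0 e'] by metis
    then obtain db where db: "\<And>b. db b > 0" "\<And>b s u. \<bar>s\<bar> < db b \<Longrightarrow> dist u a < db b \<Longrightarrow>
        (s, u) \<in> W \<and> norm (?G b s u - ?G b 0 u - s *\<^sub>R E0 b) \<le> e' * \<bar>s\<bar>" by metis
    define d where "d = Min (db ` Basis)"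
    have d: "d > 0" "\<And>b. b \<in> Basis \<Longrightarrow> d \<le> db b" using db(1) by (auto simp: d_def)
    have inW: "(s, u) \<in> W" if "\<bar>s\<bar> < d" "dist u a < d" for s u
      using db(2)[of s "SOME b. b \<in> Basis" u] d(2)[of "SOME b. b \<in> Basis"] that SOME_Basis by force
    have est: "norm (?G v s u - v - s *\<^sub>R E v) \<le> e * \<bar>s\<bar> * norm v" if su: "\<bar>s\<bar> < d" "dist u a < d" for s u v
    proof -
      define L where "L = (\<lambda>v. ?G v s u - v - s *\<^sub>R E v)"
      have lin: "linear L" unfolding L_def
        using diff[OF inW[OF su]] E
        by (intro linear_compose_sub linear_ident linear_compose_scale_right)
          (auto simp: has_derivative_linear bounded_linear.linear)
      have "L v = L (\<Sum>b\<in>Basis. (v \<bullet> b) *\<^sub>R b)" by (simp add: euclidean_representation)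
      also have "\<dots> = (\<Sum>b\<in>Basis. (v \<bullet> b) *\<^sub>R L b)"
        by (simp add: linear_sum[OF lin] linear_cmul[OF lin])
      also have "norm \<dots> \<le> (\<Sum>b\<in>(Basis::'b set). norm v * (e' * \<bar>s\<bar>))"
      proof (rule sum_norm_le)
        fix b :: 'b assume b: "b \<in> Basis"
        have "norm (?G b s u - b - s *\<^sub>R E b) \<le> e' * \<bar>s\<bar>"
          using db(2)[of s b u] d(2)[OF b] su G0[OF inW[of 0 u]] d(1) E_Basis[OF b] by simp
        then show "norm ((v \<bullet> b) *\<^sub>R L b) \<le> norm v * (e' * \<bar>s\<bar>)"
          using Basis_le_norm[OF b, of v] by (simp add: L_def mult_mono)
      qed
      also have "\<dots> = e * \<bar>s\<bar> * norm v" by (simp add: e'_def)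
      finally show ?thesis by (simp only: L_def)
    qed
    have "norm (X u - X a - E (u - a)) \<le> e * norm (u - a)" if u: "norm (u - a) < d" for u
    \<comment> \<open>The mean value inequality bounds the increment of the difference quotient of step \<open>s\<close>,
      which approximates \<^term>\<open>X u - X a\<close> up to an arbitrary \<open>\<eta>\<close> for small \<open>s\<close>.\<close>
    proof (rule field_le_epsilon)
      fix \<eta> :: real assume "\<eta> > 0"
      then have \<eta>: "\<eta> / 2 > 0" by simp
      have uW: "(0, u) \<in> W" using inW[of 0 u] u d(1) by (simp add: dist_norm)
      have quot: "\<exists>t>0. \<forall>s. \<bar>s\<bar> < t \<longrightarrow> norm (F s z - z - s *\<^sub>R X z) \<le> \<eta> / 2 * \<bar>s\<bar>" if "(0, z) \<in> W" for z
        using X[OF that] \<eta> unfolding has_vector_derivative_def has_derivative_at_alt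
        by (simp only: id[OF that] diff_zero real_norm_def)
      obtain t1 where t1: "t1 > 0" "\<And>s. \<bar>s\<bar> < t1 \<Longrightarrow> norm (F s u - u - s *\<^sub>R X u) \<le> \<eta> / 2 * \<bar>s\<bar>"
        using quot[OF uW] by blast
      obtain t2 where t2: "t2 > 0" "\<And>s. \<bar>s\<bar> < t2 \<Longrightarrow> norm (F s a - a - s *\<^sub>R X a) \<le> \<eta> / 2 * \<bar>s\<bar>"
        using quot[OF W(2)] by blast
      define s where "s = min d (min t1 t2) / 2"
      have s: "s > 0" "\<bar>s\<bar> < d" "\<bar>s\<bar> < t1" "\<bar>s\<bar> < t2" using d(1) t1(1) t2(1) by (auto simp: s_def)
      have step: "norm ((F s u - u - s *\<^sub>R E u) - (F s a - a - s *\<^sub>R E a)) \<le> e * \<bar>s\<bar> * norm (u - a)"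
      proof (rule differentiable_bound[where S = "ball a d" and f' = "\<lambda>z v. ?G v s z - v - s *\<^sub>R E v"])
        fix z assume "z \<in> ball a d"
        then have z: "dist z a < d" by (simp add: dist_commute)
        have "((\<lambda>u. F s u - u - s *\<^sub>R E u) has_derivative (\<lambda>v. ?G v s z - v - s *\<^sub>R E v)) (at z)"
          by (intro has_derivative_diff has_derivative_ident has_derivative_scaleR_right
              diff[OF inW[OF s(2) z]] bounded_linear_imp_has_derivative[OF E])
        then show "((\<lambda>u. F s u - u - s *\<^sub>R E u) has_derivative (\<lambda>v. ?G v s z - v - s *\<^sub>R E v)) (at z within ball a d)"
          by (rule has_derivative_at_withinI)
        show "onorm (\<lambda>v. ?G v s z - v - s *\<^sub>R E v) \<le> e * \<bar>s\<bar>"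
          by (rule onorm_le) (rule est[OF s(2) z])
      qed (use u d(1) in \<open>auto simp: dist_norm norm_minus_commute\<close>)
      have split: "s *\<^sub>R (X u - X a - E (u - a)) = ((F s u - u - s *\<^sub>R E u) - (F s a - a - s *\<^sub>R E a))
          - (F s u - u - s *\<^sub>R X u) + (F s a - a - s *\<^sub>R X a)"
        by (simp add: algebra_simps bounded_linear.linear[OF E] linear_diff)
      have "norm (s *\<^sub>R (X u - X a - E (u - a))) \<le> e * \<bar>s\<bar> * norm (u - a) + \<eta> / 2 * \<bar>s\<bar> + \<eta> / 2 * \<bar>s\<bar>"
        unfolding split using step t1(2)[OF s(3)] t2(2)[OF s(4)]
          norm_triangle_ineq4[of "(F s u - u - s *\<^sub>R E u) - (F s a - a - s *\<^sub>R E a)" "F s u - u - s *\<^sub>R X u"]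
          norm_triangle_ineq[of "((F s u - u - s *\<^sub>R E u) - (F s a - a - s *\<^sub>R E a)) - (F s u - u - s *\<^sub>R X u)" "F s a - a - s *\<^sub>R X a"]
        by linarith
      then have "s * norm (X u - X a - E (u - a)) \<le> s * (e * norm (u - a) + \<eta>)"
        using s(1) unfolding norm_scaleR by (simp add: distrib_left mult_ac)
      then show "norm (X u - X a - E (u - a)) \<le> e * norm (u - a) + \<eta>"
        using s(1) by (simp only: mult_le_cancel_left_pos)
    qed
    then show "\<exists>d>0. \<forall>u. norm (u - a) < d \<longrightarrow> norm (X u - X a - E (u - a)) \<le> e * norm (u - a)"
      using d(1) by blast
  qed
  moreover have "((\<lambda>s. ?G b s a) has_vector_derivative E b) (at 0)" if "b \<in> Basis" for b
    using E0[of b] E_Basis[OF that] by simp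
  ultimately show ?thesis using that by blast
qed

section \<open>The linear response of the transfer operator\<close>

lemma DERIV_quotient_at_one:
  fixes N d :: "real \<Rightarrow> real"
  assumes "(N has_real_derivative N') (at t)" "(d has_real_derivative d') (at t)" "d t = 1"
  shows "((\<lambda>s. N s / d s) has_real_derivative N' - N t * d') (at t)"
  using DERIV_divide[OF assms(1,2)] assms(3) by simp

context riemannian
begin

text \<open>
  The derivative is computed in an arbitrary chart around \<^term>\<open>x\<close>, with the divergence taken in the
  same chart.
\<close>

theorem transfer_has_derivative:
  assumes h: "smooth_fun A h" "\<And>p. h p \<ge> 0"
    and J: "open J" "0 \<in> J"
    and f: "C1_family_of_Ck_diffeos A (Suc (Suc k)) J f" "f 0 = id"
    and X: "is_variation_field A f X"
    and c: "c \<in> A" "x \<in> dom_of c"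
  shows "((\<lambda>\<gamma>. transfer A g (f \<gamma>) h x) has_real_derivative
    - chart_divergence g c (\<lambda>c p. h p *\<^sub>R X c p) x) (at 0)"
proof -
  define a where "a = coord c x"
  define F where "F = (\<lambda>\<gamma> u. coord c (f \<gamma> (param c u)))"
  define W where "W = {(\<gamma>, u). \<gamma> \<in> J \<and> u \<in> img c \<and> f \<gamma> (param c u) \<in> dom_of c}"
  define \<rho> where "\<rho> = (\<lambda>u. vol_density g c (param c u))"
  define w where "w = (\<lambda>u. h (param c u) * \<rho> u)"
  define V where "V = (\<lambda>u. X c (param c u))"
  have a: "a \<in> img c" "param c a = x" using c by (auto simp: a_def param_coord)
  have diffeo: "Ck_diffeo A (Suc (Suc k)) (f \<gamma>)" if "\<gamma> \<in> J" for \<gamma>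
    using f(1) that by (simp add: C1_family_of_Ck_diffeos_def)
  have C1: "C1_Ck_on (Suc (Suc k)) W F"
    using f(1) c(1) unfolding C1_family_of_Ck_diffeos_def W_def F_def by blast
  have C0: "C1_C0_on W F" using C1 by simp
  have C0': "C1_C0_on W (\<lambda>\<gamma> u. frechet_derivative (F \<gamma>) (at u) v)" for v using C1 by simp
  have W: "open W"
  proof -
    have "continuous_on (J \<times> UNIV) (\<lambda>(\<gamma>, p). f \<gamma> p)"
      using f(1) by (simp add: C1_family_of_Ck_diffeos_def)
    moreover have "continuous_on (J \<times> img c) (\<lambda>z. (fst z, param c (snd z)))"
      by (intro continuous_intros continuous_on_compose2[OF continuous_on_param[OF c(1)]]) auto
    ultimately have "continuous_on (J \<times> img c) (\<lambda>z. (\<lambda>(\<gamma>, p). f \<gamma> p) (fst z, param c (snd z)))"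
      by (rule continuous_on_compose2) auto
    then have "open ((J \<times> img c) \<inter> (\<lambda>z. (\<lambda>(\<gamma>, p). f \<gamma> p) (fst z, param c (snd z))) -` dom_of c)"
      by (rule continuous_open_preimage) (intro open_Times J open_img open_dom c)+
    also have "(J \<times> img c) \<inter> (\<lambda>z. (\<lambda>(\<gamma>, p). f \<gamma> p) (fst z, param c (snd z))) -` dom_of c = W"
      unfolding W_def by auto
    finally show ?thesis .
  qed
  have W0: "(0, u) \<in> W \<longleftrightarrow> u \<in> img c" for u
    using J(2) f(2) param_dom[of u c] by (auto simp: W_def)
  have F0: "F 0 u = u" if "(0, u) \<in> W" for u
    using that f(2) coord_param[of u c] by (simp add: W0 F_def)
  have aW: "(0, a) \<in> W" using a W0 by simp
  have FV: "((\<lambda>s. F s u) has_vector_derivative V u) (at 0)" if "(0, u) \<in> W" for u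
    using X c(1) param_dom[of u c] that unfolding is_variation_field_def F_def V_def W0 by blast
  obtain E where E: "(V has_derivative E) (at a)"
    "\<And>b. b \<in> Basis \<Longrightarrow> ((\<lambda>s. frechet_derivative (F s) (at a) b) has_vector_derivative E b) (at 0)"
    using velocity_field_has_derivative[OF C1 W aW F0 FV] by blast

  \<comment> \<open>The coordinates of the preimage of \<^term>\<open>x\<close>.\<close>
  define y where "y = (\<lambda>\<gamma>. coord c (inv (f \<gamma>) x))"
  have y0: "y 0 = a" using f(2) by (simp add: y_def a_def)
  have solution: "inv (f \<gamma>) x \<in> dom_of c \<and> y \<gamma> = u" if "(\<gamma>, u) \<in> W" "F \<gamma> u = a" for \<gamma> u
  proof -
    have \<gamma>: "\<gamma> \<in> J" "u \<in> img c" "f \<gamma> (param c u) \<in> dom_of c" using that by (auto simp: W_def)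
    have "f \<gamma> (param c u) = x"
      using that(2) \<gamma>(3) c inj_onD[OF inj_on_coord[OF c(1)]] by (simp add: F_def a_def)
    moreover have "inj (f \<gamma>)" using diffeo[OF \<gamma>(1)] by (simp add: Ck_diffeo_def bij_is_inj)
    ultimately have "inv (f \<gamma>) x = param c u" by (metis inv_f_f)
    then show ?thesis using \<gamma>(2) param_dom coord_param by (simp add: y_def)
  qed
  \<comment> \<open>By injectivity of \<^term>\<open>f \<gamma>\<close>, a solution found by Brouwer's theorem is the preimage of \<^term>\<open>x\<close>; this
    gives continuity of \<^term>\<open>y\<close> at \<open>0\<close> without continuity of the inverses in \<^term>\<open>\<gamma>\<close>.\<close>
  have near: "\<exists>d>0. \<forall>\<gamma>. \<bar>\<gamma>\<bar> < d \<longrightarrow> dist (y \<gamma>) a \<le> r \<and> (\<gamma>, y \<gamma>) \<in> W \<and> F \<gamma> (y \<gamma>) = a \<and> inv (f \<gamma>) x \<in> dom_of c"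
    if r: "r > 0" for r
  proof -
    obtain d where "d > 0" "\<And>\<gamma>. \<bar>\<gamma>\<bar> < d \<Longrightarrow> \<exists>u. dist u a \<le> r \<and> (\<gamma>, u) \<in> W \<and> F \<gamma> u = a"
      using solve_near_identity[OF C0 W aW FV[OF aW] F0 r] by blast
    then show ?thesis using solution by (metis (no_types, lifting))
  qed
  obtain d0 where d0: "d0 > 0" "\<And>\<gamma>. \<bar>\<gamma>\<bar> < d0 \<Longrightarrow> (\<gamma>, y \<gamma>) \<in> W \<and> F \<gamma> (y \<gamma>) = a \<and> inv (f \<gamma>) x \<in> dom_of c"
    using near[of 1] by auto
  have nhd: "\<forall>\<^sub>F \<gamma> in nhds 0. \<bar>\<gamma>\<bar> < d0"
    unfolding eventually_nhds_metric using d0(1) by (intro exI[of _ d0]) (simp add: dist_real_def)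
  have y_cont: "isCont y 0"
    unfolding continuous_at_eps_delta
  proof (intro allI impI)
    fix e :: real assume "e > 0"
    then obtain d where "d > 0" "\<And>\<gamma>. \<bar>\<gamma>\<bar> < d \<Longrightarrow> dist (y \<gamma>) a \<le> e / 2" using near[of "e / 2"] by auto
    then show "\<exists>d>0. \<forall>\<gamma>. dist \<gamma> 0 < d \<longrightarrow> dist (y \<gamma>) (y 0) < e"
      using y0 \<open>e > 0\<close> by (intro exI[of _ d]) (fastforce simp: dist_real_def)
  qed
  have y': "(y has_vector_derivative - V a) (at 0)"
  proof (rule solution_path_derivative[OF C0 W aW FV[OF aW] _ y_cont y0])
    show "\<forall>\<^sub>F s in nhds 0. F s (y s) = a" using nhd by eventually_elim (use d0(2) in blast)
  qed (rule F0)

  \<comment> \<open>The derivative of the determinant along this path is the trace of \<^term>\<open>E\<close>, that is the coordinate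
    divergence of \<^term>\<open>V\<close>.\<close>
  define D where "D = (\<lambda>\<gamma>. matrix (frechet_derivative (F \<gamma>) (at (y \<gamma>))))"
  have id': "frechet_derivative (F 0) (at u) v = v" if "(0, u) \<in> W" for u v
  proof -
    have "(F 0 has_derivative (\<lambda>v. v)) (at u)"
      by (rule has_derivative_transform_within_open[OF has_derivative_ident open_img[OF c(1)]])
        (use that F0 W0 in auto)
    then show ?thesis using frechet_derivative_at by metis
  qed
  have "((\<lambda>s. frechet_derivative (F s) (at (y s)) b) has_vector_derivative E b) (at 0)" if "b \<in> Basis" for b
    by (rule C1_C0_along_path[OF C0' W aW E(2)[OF that] _ y_cont y0]) (simp add: id' aW)
  then have "((\<lambda>s. frechet_derivative (F s) (at (y s)) (axis j 1) $ i) has_vector_derivative E (axis j 1) $ i) (at 0)" for i j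
    by (intro bounded_linear.has_vector_derivative[OF bounded_linear_vec_nth]) simp
  then have Dij: "((\<lambda>s. D s $ i $ j) has_real_derivative (matrix E) $ i $ j) (at 0)" for i j
    by (simp add: D_def matrix_def has_real_derivative_iff_has_vector_derivative)
  have D0: "D 0 = mat 1" unfolding D_def y0 using id'[OF aW] by (simp add: matrix_def mat_def vec_eq_iff axis_def)
  have detD: "((\<lambda>s. det (D s)) has_real_derivative (\<Sum>i\<in>UNIV. E (axis i 1) $ i)) (at 0)"
    using has_real_derivative_det_mat_1[OF Dij D0] by (simp add: matrix_def)

  \<comment> \<open>Near \<open>0\<close> the determinant is positive and the absolute value in the Jacobian can be dropped.\<close>
  have \<rho>a: "\<rho> a > 0" using vol_density_pos[OF c] a by (simp add: \<rho>_def)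
  have h_cont: "continuous_on UNIV h" using h(1) by (auto simp: smooth_fun_def intro: Ck_fun_continuous)
  have "isCont (\<lambda>s. det (D s)) 0" using detD by (rule DERIV_isCont)
  then have "((\<lambda>s. det (D s)) \<longlongrightarrow> det (D 0)) (nhds 0)"
    using tendsto_at_iff_tendsto_nhds[of "\<lambda>s. det (D s)" 0] by (simp add: isCont_def)
  then have "\<forall>\<^sub>F s in nhds 0. det (D s) > 0"
    by (rule order_tendstoD) (simp add: D0)
  then have "\<forall>\<^sub>F \<gamma> in nhds 0. transfer A g (f \<gamma>) h x = w (y \<gamma>) / det (D \<gamma>) / \<rho> a"
    using nhd
  proof eventually_elim
    case (elim \<gamma>)
    define q where "q = inv (f \<gamma>) x"
    have \<gamma>: "\<gamma> \<in> J" "q \<in> dom_of c" using d0(2)[OF elim(2)] by (auto simp: W_def q_def)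
    have "bij (f \<gamma>)" and map: "Ck_map A (Suc (Suc k)) (f \<gamma>)" using diffeo[OF \<gamma>(1)] by (auto simp: Ck_diffeo_def)
    then have fq: "f \<gamma> q = x" by (simp add: q_def bij_is_surj surj_f_inv_f)
    have yq: "y \<gamma> = coord c q" "param c (y \<gamma>) = q" using \<gamma>(2) c(1) by (auto simp: y_def q_def param_coord)
    have "transfer A g (f \<gamma>) h x = h q / jacobian (f \<gamma>) q"
      unfolding transfer_eq_pushforward[OF diffeo[OF \<gamma>(1)] h_cont h(2)] by (simp add: pushforward_def q_def)
    also have "jacobian (f \<gamma>) q = chart_jacobian c c (f \<gamma>) q"
      by (rule jacobian_eq[OF c(1) c(1) \<gamma>(2) _ map]) (simp add: fq c)
    also have "\<dots> = det (D \<gamma>) * \<rho> a / \<rho> (y \<gamma>)"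
    proof -
      have "coord c \<circ> f \<gamma> \<circ> param c = F \<gamma>" by (simp add: F_def fun_eq_iff)
      then show ?thesis using elim(1) by (simp add: chart_jacobian_def D_def \<rho>_def yq fq a(2) flip: yq(1))
    qed
    finally show ?case
      using vol_density_pos[OF c(1) \<gamma>(2)] by (simp add: w_def \<rho>_def yq(2) field_simps)
  qed
  moreover have "((\<lambda>\<gamma>. w (y \<gamma>) / det (D \<gamma>) / \<rho> a) has_real_derivative
      - chart_divergence g c (\<lambda>c p. h p *\<^sub>R X c p) x) (at 0)"
  proof -
    have "Ck_on 1 (img c) (h \<circ> param c)" using h(1) c(1) unfolding smooth_fun_def Ck_fun_def by blast
    then have "(\<lambda>u. h (param c u)) differentiable (at a)"
      using Ck_on_has_derivative[of 0 "img c" "h \<circ> param c" a] a(1) by (auto simp: differentiable_def o_def)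
    moreover have "\<rho> differentiable (at a)"
      unfolding \<rho>_def by (rule differentiable_vol_density[OF c(1) a(1)])
    ultimately have "w differentiable (at a)" unfolding w_def by (rule differentiable_mult)
    then obtain w' where w': "(w has_derivative w') (at a)" by (auto simp: differentiable_def)
    interpret w': bounded_linear w' using w' by (rule has_derivative_bounded_linear)
    have "((\<lambda>\<gamma>. w (y \<gamma>)) has_derivative (\<lambda>t. w' (t *\<^sub>R (- V a)))) (at 0)"
      using has_derivative_compose[OF y'[unfolded has_vector_derivative_def]] w' y0 by simp
    then have "((\<lambda>\<gamma>. w (y \<gamma>)) has_real_derivative - w' (V a)) (at 0)"
      unfolding has_field_derivative_def
      by (rule has_derivative_eq_rhs) (auto simp: w'.scaleR w'.neg)
    from DERIV_quotient_at_one[OF this detD]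
    have "((\<lambda>\<gamma>. w (y \<gamma>) / det (D \<gamma>) / \<rho> a) has_real_derivative
        (- w' (V a) - w a * (\<Sum>i\<in>UNIV. E (axis i 1) $ i)) / \<rho> a) (at 0)"
      using D0 y0 by (intro DERIV_cdivide) simp
    moreover have "chart_divergence g c (\<lambda>c p. h p *\<^sub>R X c p) x =
        (w' (V a) + w a * (\<Sum>i\<in>UNIV. E (axis i 1) $ i)) / \<rho> a"
    proof -
      have "frechet_derivative (\<lambda>u. vol_density g c (param c u) * (h (param c u) *\<^sub>R X c (param c u)) $ i) (at a) (axis i 1)
          = w a * E (axis i 1) $ i + w' (axis i 1) * V a $ i" for i
      proof -
        have "((\<lambda>u. w u * V u $ i) has_derivative (\<lambda>v. w a * E v $ i + w' v * V a $ i)) (at a)"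
          by (intro has_derivative_mult w' bounded_linear.has_derivative[OF bounded_linear_vec_nth] E(1))
        moreover have "(\<lambda>u. w u * V u $ i) = (\<lambda>u. vol_density g c (param c u) * (h (param c u) *\<^sub>R X c (param c u)) $ i)"
          by (simp add: w_def \<rho>_def V_def fun_eq_iff)
        ultimately have "((\<lambda>u. vol_density g c (param c u) * (h (param c u) *\<^sub>R X c (param c u)) $ i)
            has_derivative (\<lambda>v. w a * E v $ i + w' v * V a $ i)) (at a)" by (simp only:)
        from frechet_derivative_at[OF this, symmetric] show ?thesis by (simp only:)
      qed
      moreover have "w' (V a) = (\<Sum>i\<in>UNIV. w' (axis i 1) * V a $ i)"
      proof -
        have "w' (V a) = w' (\<Sum>i\<in>UNIV. V a $ i *\<^sub>R axis i 1)"
          using basis_expansion[of "V a"] by (simp add: scalar_mult_eq_scaleR)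
        then show ?thesis by (simp add: w'.sum w'.scaleR mult.commute)
      qed
      ultimately show ?thesis
        unfolding chart_divergence_def a_def[symmetric]
        by (simp add: sum.distrib sum_distrib_left \<rho>_def a(2) add.commute)
    qed
    ultimately show ?thesis by (simp add: minus_divide_left algebra_simps)
  qed
  ultimately show ?thesis
    by (subst DERIV_cong_ev[OF refl _ refl])
qed

end

theorem lemma1:
  fixes A :: "('a::{second_countable_topology, t2_space}, 'n::finite) chart set"
    and g :: "('a, 'n) chart \<Rightarrow> 'a \<Rightarrow> real ^ 'n ^ 'n"
    and h :: "'a \<Rightarrow> real"
    and J :: "real set"
    and f :: "real \<Rightarrow> 'a \<Rightarrow> 'a"
    and X :: "('a, 'n) chart \<Rightarrow> 'a \<Rightarrow> real ^ 'n"
    and x :: 'a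
  assumes "riemannian_manifold A g"
    and "smooth_fun A h" and "\<And>p. h p \<ge> 0"
    and "open J" and "0 \<in> J"
    and "C1_family_of_Ck_diffeos A 3 J f"
    and "f 0 = id"
    and "is_variation_field A f X"
    and "h x > 0"
  shows "(\<lambda>\<gamma>. transfer A g (f \<gamma>) h x) differentiable (at 0) \<and>
    - deriv (\<lambda>\<gamma>. transfer A g (f \<gamma>) h x) 0 / h x
      = divergence A g (\<lambda>c p. h p *\<^sub>R X c p) x / h x \<and>
    divergence A g (\<lambda>c p. h p *\<^sub>R X c p) x / h x = weighted_divergence A g h X x"
proof -
  interpret riemannian A g by standard (rule assms)
  let ?V = "\<lambda>c p. h p *\<^sub>R X c p" and ?k = "\<lambda>\<gamma>. transfer A g (f \<gamma>) h x"
  have fam: "C1_family_of_Ck_diffeos A (Suc (Suc 1)) J f"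
    using assms(6) by (simp add: numeral_3_eq_3)
  have der: "(?k has_real_derivative - chart_divergence g c ?V x) (at 0)" if "c \<in> A" "x \<in> dom_of c" for c
    by (rule transfer_has_derivative[OF assms(2-5) fam assms(7,8) that])
  \<comment> \<open>The right-hand side does not involve the chart, so all chart divergences coincide and the
    description that defines the divergence denotes their common value.\<close>
  have div_eq: "chart_divergence g c ?V x = - deriv ?k 0" if "c \<in> A" "x \<in> dom_of c" for c
    using DERIV_imp_deriv[OF der[OF that]] by simp
  obtain c where c: "c \<in> A" "x \<in> dom_of c" by (rule chart_at)
  have "divergence A g ?V x = - deriv ?k 0"
    unfolding divergence_def by (rule the_equality) (use div_eq c in auto)
  moreover have "?k differentiable (at 0)"
    using der[OF c] by (auto simp: has_field_derivative_def differentiable_def)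
  ultimately show ?thesis by (simp add: weighted_divergence_def)
qed

end
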